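(* The problem Min-ICR-Exact is solvable in polynomial time when restricted to inputs $(I,\succ_{M,W},\mu)$ in which $I$ is an instance of SMTI where all men have the same indifference classes and all women have the same indifference classes; that is, writing $C^a_t$ for the $t$-th indifference class of agent $a$, $C^{m}_i=C^{m'}_i$ for all $m,m'\in M$ and all $i\in\{1,\dots,n\}$, and $C^{w}_i=C^{w'}_i$ for all $w,w'\in W$ and all $i\in\{1,\dots,n\}$.
   Context: SMPI. An instance $I=(M,W,p_{M,W})$ of SMPI (Stable Marriage with Partially ordered preferences and Incomplete lists) consists of $n$ men $M$, $n$ women $W$, a set of mutually acceptable (man, woman) pairs, and for each agent $a\in M\cup W$ a strict partial order $p_a$ on the set of $a$'s acceptable candidates (agents of the opposite side). $(c_1,c_2)\in p_a$ means $a$ strictly prefers $c_1$ to $c_2$; $a$ cannot compare distinct $c_1,c_2$ if neither $(c_1,c_2)$ nor $(c_2,c_1)$ is in $p_a$. Every agent strictly prefers each acceptable candidate to being unmatched. SMTI is the special case in which each agent's incomparability relation is transitive: each agent $a$'s acceptable candidates are partitioned into indifference classes (ties) $C^a_1,C^a_2,\dots,C^a_n$, listed from most to least preferred (with $C^a_t=\emptyset$ implying $C^a_{t'}=\emptyset$ for all $t'>t$), and two candidates are incomparable exactly when they are in the same class. Refinement. An instance $I'$ (same agents and acceptable pairs, with relations $p'_a$) refines $I$ if for each agent $a$ every strict total order that is a linear extension of $p'_a$ is a linear extension of $p_a$. A strict preference profile $\succ_{M,W}=(\succ_a)_{a\in M\cup W}$ (each $\succ_a$ a strict total order on $a$'s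 acceptable candidates) refines $I$ iff $p_a\subseteq\ \succ_a$ for all $a$. Interviews. An interview is a mutually acceptable pair $(m,w)$; it is informative to both. Carrying out a set $T$ of interviews on $I$ yields an instance $I'$ exactly the same as $I$ except that each agent $a$ now strictly orders the candidates he/she interviewed: writing $T(a)$ for the candidates interviewed by $a$, $p'_a=p_a\cup L_a$, where $L_a$ is a strict total order on $T(a)$ and $p'_a$ is acyclic; no other pairs are added. Such an $I'$ is an interview-compatible refinement of $I$, and its cost (given $I$) is the minimum $|T|$ over sets $T$ of interviews that refine $I$ into $I'$. Stability. A matching $\mu$ is a set of mutually acceptable pairs in which each agent appears at most once. $\mu$ is weakly stable if no acceptable pair $(m,w)\notin\mu$ is such that each of $m,w$ is unmatched or strictly prefers the other to his/her partner. A very weak blocking pair is an acceptable pair $(m,w)\notin\mu$ such that each of $m,w$ is unmatched, or strictly prefers the other to his/her partner, or cannot compare the other with his/her partner. $\mu$ is super-stable if it has no very weak blocking pair. Min-ICR-Exact. Input: $(I,\succ_{M,W},\mu)$ with $I$ an SMPI instance, $\succ_{M,W}$ a strict preference profile refining $I$, and $\mu$ a matching weakly stable w.r.t. $\succ_{M,W}$. Task: find an interview-compatible refinement $I'$ of $I$ such that (i) $\succ_{M,W}$ refines $I'$, (ii) $\mu$ is super-stable in $I'$, and (iii) $I'$ has minimum cost among interview-compatible refinements of $I$ satisfying (i) and (ii). *)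

theory Defs
  imports "HOL-Computational_Algebra.Polynomial"
begin

section \<open>Instances\<close>

datatype agent = Man nat | Woman nat

text \<open>The \<open>n\<close> men and the \<open>n\<close> women are named by the numbers below \<open>n\<close>. Acceptable pairs are
  listed as (man, woman), and \<open>(c, d) \<in> pref I a\<close> means that \<open>a\<close> strictly prefers \<open>c\<close> to \<open>d\<close>.
  The value of \<open>pref I\<close> at a name that is not an agent of \<open>I\<close> is irrelevant everywhere below.\<close>

record instance_data =
  num :: nat
  acc :: "(agent \<times> agent) set"
  pref :: "agent \<Rightarrow> (agent \<times> agent) set"

type_synonym profile = "agent \<Rightarrow> (agent \<times> agent) set"

definition men :: "instance_data \<Rightarrow> agent set" where
  "men I = Man ` {..<num I}"

definition women :: "instance_data \<Rightarrow> agent set" where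
  "women I = Woman ` {..<num I}"

definition agents :: "instance_data \<Rightarrow> agent set" where
  "agents I = men I \<union> women I"

text \<open>A set \<open>X\<close> of (man, woman) pairs is also read as an undirected relation: acceptability,
  interviews and matchings all use \<open>opposite\<close>.\<close>

definition opposite :: "(agent \<times> agent) set \<Rightarrow> agent \<Rightarrow> agent set" where
  "opposite X a = {c. (a, c) \<in> X \<or> (c, a) \<in> X}"

abbreviation candidates :: "instance_data \<Rightarrow> agent \<Rightarrow> agent set" where
  "candidates I a \<equiv> opposite (acc I) a"

definition SMPI :: "instance_data \<Rightarrow> bool" where
  "SMPI I \<longleftrightarrow> acc I \<subseteq> men I \<times> women I \<and>
     (\<forall>a\<in>agents I. pref I a \<subseteq> candidates I a \<times> candidates I a \<and>
        irrefl (pref I a) \<and> trans (pref I a))"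

definition incomparable :: "instance_data \<Rightarrow> agent \<Rightarrow> agent \<Rightarrow> agent \<Rightarrow> bool" where
  "incomparable I a c d \<longleftrightarrow> c \<noteq> d \<and> (c, d) \<notin> pref I a \<and> (d, c) \<notin> pref I a"

text \<open>\<open>C 1, \<dots>, C n\<close> are the indifference classes of \<open>a\<close>, from most to least preferred.\<close>

definition indifference_classes :: "instance_data \<Rightarrow> agent \<Rightarrow> (nat \<Rightarrow> agent set) \<Rightarrow> bool" where
  "indifference_classes I a C \<longleftrightarrow>
     (\<Union>t\<in>{1..num I}. C t) = candidates I a \<and>
     (\<forall>s\<in>{1..num I}. \<forall>t\<in>{1..num I}. s \<noteq> t \<longrightarrow> C s \<inter> C t = {}) \<and>
     (\<forall>s\<in>{1..num I}. \<forall>t\<in>{1..num I}. s < t \<longrightarrow> C s = {} \<longrightarrow> C t = {}) \<and>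
     pref I a = {(c, d). \<exists>s\<in>{1..num I}. \<exists>t\<in>{1..num I}. s < t \<and> c \<in> C s \<and> d \<in> C t}"

definition SMTI_common_classes :: "instance_data \<Rightarrow> bool" where
  "SMTI_common_classes I \<longleftrightarrow> SMPI I \<and>
     (\<exists>C. (\<forall>a\<in>agents I. indifference_classes I a (C a)) \<and>
          (\<forall>m\<in>men I. \<forall>m'\<in>men I. \<forall>i\<in>{1..num I}. C m i = C m' i) \<and>
          (\<forall>w\<in>women I. \<forall>w'\<in>women I. \<forall>i\<in>{1..num I}. C w i = C w' i))"


section \<open>Interviews and refinements\<close>

definition strict_total_order_on :: "agent set \<Rightarrow> (agent \<times> agent) set \<Rightarrow> bool" where
  "strict_total_order_on A r \<longleftrightarrow> r \<subseteq> A \<times> A \<and> strict_linear_order_on A r"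

definition strict_profile :: "instance_data \<Rightarrow> profile \<Rightarrow> bool" where
  "strict_profile I P \<longleftrightarrow> (\<forall>a\<in>agents I. strict_total_order_on (candidates I a) (P a))"

definition profile_refines :: "profile \<Rightarrow> instance_data \<Rightarrow> bool" where
  "profile_refines P I \<longleftrightarrow> (\<forall>a\<in>agents I. pref I a \<subseteq> P a)"

text \<open>\<open>interviews_yield I T I'\<close>: carrying out the interviews \<open>T\<close> on \<open>I\<close> can result in \<open>I'\<close>.\<close>

definition interviews_yield ::
  "instance_data \<Rightarrow> (agent \<times> agent) set \<Rightarrow> instance_data \<Rightarrow> bool" where
  "interviews_yield I T I' \<longleftrightarrow> T \<subseteq> acc I \<and> num I' = num I \<and> acc I' = acc I \<and>
     (\<forall>a\<in>agents I. \<exists>L. strict_total_order_on (opposite T a) L \<and>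
        pref I' a = pref I a \<union> L \<and> acyclic (pref I' a))"

definition interview_compatible_refinement :: "instance_data \<Rightarrow> instance_data \<Rightarrow> bool" where
  "interview_compatible_refinement I I' \<longleftrightarrow> (\<exists>T. interviews_yield I T I')"

definition cost :: "instance_data \<Rightarrow> instance_data \<Rightarrow> nat" where
  "cost I I' = (LEAST k. \<exists>T. interviews_yield I T I' \<and> card T = k)"


section \<open>Stability\<close>

definition matching :: "instance_data \<Rightarrow> (agent \<times> agent) set \<Rightarrow> bool" where
  "matching I \<mu> \<longleftrightarrow> \<mu> \<subseteq> acc I \<and>
     (\<forall>a\<in>agents I. \<forall>c\<in>opposite \<mu> a. \<forall>d\<in>opposite \<mu> a. c = d)"

text \<open>Strict preference of \<open>a\<close> for \<open>c\<close> over the partner, every acceptable candidate being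
  preferred to having no partner.\<close>

definition prefers_to_partner ::
  "instance_data \<Rightarrow> (agent \<times> agent) set \<Rightarrow> agent \<Rightarrow> agent \<Rightarrow> bool" where
  "prefers_to_partner I \<mu> a c \<longleftrightarrow>
     opposite \<mu> a = {} \<or> (\<exists>d\<in>opposite \<mu> a. (c, d) \<in> pref I a)"

definition weakly_stable :: "instance_data \<Rightarrow> (agent \<times> agent) set \<Rightarrow> bool" where
  "weakly_stable I \<mu> \<longleftrightarrow>
     \<not> (\<exists>(m, w) \<in> acc I - \<mu>. prefers_to_partner I \<mu> m w \<and> prefers_to_partner I \<mu> w m)"

definition incomparable_to_partner ::
  "instance_data \<Rightarrow> (agent \<times> agent) set \<Rightarrow> agent \<Rightarrow> agent \<Rightarrow> bool" where
  "incomparable_to_partner I \<mu> a c \<longleftrightarrow> (\<exists>d\<in>opposite \<mu> a. incomparable I a c d)"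

definition very_weak_blocking_pair ::
  "instance_data \<Rightarrow> (agent \<times> agent) set \<Rightarrow> agent \<Rightarrow> agent \<Rightarrow> bool" where
  "very_weak_blocking_pair I \<mu> m w \<longleftrightarrow> (m, w) \<in> acc I - \<mu> \<and>
     (prefers_to_partner I \<mu> m w \<or> incomparable_to_partner I \<mu> m w) \<and>
     (prefers_to_partner I \<mu> w m \<or> incomparable_to_partner I \<mu> w m)"

definition super_stable :: "instance_data \<Rightarrow> (agent \<times> agent) set \<Rightarrow> bool" where
  "super_stable I \<mu> \<longleftrightarrow> \<not> (\<exists>m w. very_weak_blocking_pair I \<mu> m w)"


section \<open>The problem Min-ICR-Exact\<close>

type_synonym icr_input = "instance_data \<times> profile \<times> (agent \<times> agent) set"

text \<open>Weak stability with respect to a profile is weak stability in the instance whose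
  preferences are that profile.\<close>

fun min_ICR_exact_input :: "icr_input \<Rightarrow> bool" where
  "min_ICR_exact_input (I, P, \<mu>) \<longleftrightarrow>
     SMPI I \<and> strict_profile I P \<and> profile_refines P I \<and>
     matching I \<mu> \<and> weakly_stable (I\<lparr>pref := P\<rparr>) \<mu>"

fun ICR_exact_feasible :: "icr_input \<Rightarrow> instance_data \<Rightarrow> bool" where
  "ICR_exact_feasible (I, P, \<mu>) I' \<longleftrightarrow>
     interview_compatible_refinement I I' \<and> profile_refines P I' \<and> super_stable I' \<mu>"

fun min_ICR_exact_solution :: "icr_input \<Rightarrow> instance_data \<Rightarrow> bool" where
  "min_ICR_exact_solution (I, P, \<mu>) I' \<longleftrightarrow>
     ICR_exact_feasible (I, P, \<mu>) I' \<and>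
     (\<forall>I''. ICR_exact_feasible (I, P, \<mu>) I'' \<longrightarrow> cost I I' \<le> cost I I'')"


section \<open>Encoding as bit strings\<close>

text \<open>\<open>n\<close> in unary, followed by \<open>n \<times> n\<close> adjacency matrices in row-major order.\<close>

definition enc_matrix ::
  "agent list \<Rightarrow> agent list \<Rightarrow> (agent \<times> agent) set \<Rightarrow> bool list" where
  "enc_matrix cs ds R = [(c, d) \<in> R. c \<leftarrow> cs, d \<leftarrow> ds]"

definition enc_pairs :: "nat \<Rightarrow> (agent \<times> agent) set \<Rightarrow> bool list" where
  "enc_pairs n X = enc_matrix (map Man [0..<n]) (map Woman [0..<n]) X"

definition enc_profile :: "nat \<Rightarrow> profile \<Rightarrow> bool list" where
  "enc_profile n p =
     concat (map (\<lambda>i. enc_matrix (map Woman [0..<n]) (map Woman [0..<n]) (p (Man i))) [0..<n]) @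
     concat (map (\<lambda>i. enc_matrix (map Man [0..<n]) (map Man [0..<n]) (p (Woman i))) [0..<n])"

definition enc_instance :: "instance_data \<Rightarrow> bool list" where
  "enc_instance I =
     replicate (num I) True @ [False] @ enc_pairs (num I) (acc I) @ enc_profile (num I) (pref I)"

fun enc_input :: "icr_input \<Rightarrow> bool list" where
  "enc_input (I, P, \<mu>) = enc_instance I @ enc_profile (num I) P @ enc_pairs (num I) \<mu>"


section \<open>Polynomial-time computation\<close>

text \<open>A random access machine with registers and an indirectly addressed memory, both holding
  natural numbers. Every executed instruction costs one time unit. Since the only arithmetic is
  addition and truncated subtraction, after \<open>t\<close> steps all numbers have length at most \<open>t\<close> plus
  that of the largest number present initially or in the program, and so polynomial time on this
  machine is the same as polynomial time on Turing machines.\<close>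

datatype instr =
    Const nat nat     \<comment> \<open>\<open>Const r k\<close>: \<open>R r := k\<close>\<close>
  | Add nat nat nat   \<comment> \<open>\<open>Add r s t\<close>: \<open>R r := R s + R t\<close>\<close>
  | Sub nat nat nat   \<comment> \<open>\<open>Sub r s t\<close>: \<open>R r := R s - R t\<close>\<close>
  | Load nat nat      \<comment> \<open>\<open>Load r s\<close>: \<open>R r := M (R s)\<close>\<close>
  | Store nat nat     \<comment> \<open>\<open>Store r s\<close>: \<open>M (R r) := R s\<close>\<close>
  | Jump nat          \<comment> \<open>\<open>Jump l\<close>: go to instruction \<open>l\<close>\<close>
  | Jump_zero nat nat \<comment> \<open>\<open>Jump_zero r l\<close>: go to instruction \<open>l\<close> if \<open>R r = 0\<close>\<close>

type_synonym config = "nat \<times> (nat \<Rightarrow> nat) \<times> (nat \<Rightarrow> nat)"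

fun exec :: "instr \<Rightarrow> config \<Rightarrow> config" where
  "exec (Const r k) (pc, R, M) = (Suc pc, R(r := k), M)"
| "exec (Add r s t) (pc, R, M) = (Suc pc, R(r := R s + R t), M)"
| "exec (Sub r s t) (pc, R, M) = (Suc pc, R(r := R s - R t), M)"
| "exec (Load r s) (pc, R, M) = (Suc pc, R(r := M (R s)), M)"
| "exec (Store r s) (pc, R, M) = (Suc pc, R, M(R r := R s))"
| "exec (Jump l) (pc, R, M) = (l, R, M)"
| "exec (Jump_zero r l) (pc, R, M) = (if R r = 0 then l else Suc pc, R, M)"

text \<open>The machine halts when the program counter leaves the program.\<close>

definition step :: "instr list \<Rightarrow> config \<Rightarrow> config" where
  "step prog c = (if fst c < length prog then exec (prog ! fst c) c else c)"

text \<open>The bits of a string are found in the memory cells from 0 on, its length in register 0;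
  initially all other cells and registers are 0.\<close>

definition init_config :: "bool list \<Rightarrow> config" where
  "init_config xs =
     (0, (\<lambda>r. if r = 0 then length xs else 0),
         (\<lambda>i. if i < length xs then of_bool (xs ! i) else 0))"

fun halted_with :: "instr list \<Rightarrow> config \<Rightarrow> bool list \<Rightarrow> bool" where
  "halted_with prog (pc, R, M) ys \<longleftrightarrow>
     length prog \<le> pc \<and> R 0 = length ys \<and> (\<forall>i<length ys. M i = of_bool (ys ! i))"

text \<open>\<open>X\<close> is the set of inputs to which the search problem \<open>Sol\<close> is restricted: nothing is
  required of the machine on strings that do not encode an element of \<open>X\<close>.\<close>

definition solvable_in_polynomial_time ::
  "'x set \<Rightarrow> ('x \<Rightarrow> bool list) \<Rightarrow> ('y \<Rightarrow> bool list) \<Rightarrow> ('x \<Rightarrow> 'y \<Rightarrow> bool) \<Rightarrow> bool" where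
  "solvable_in_polynomial_time X enc_in enc_out Sol \<longleftrightarrow>
     (\<exists>prog (q :: nat poly). \<forall>x\<in>X. \<exists>t y.
        t \<le> poly q (length (enc_in x)) \<and>
        halted_with prog ((step prog ^^ t) (init_config (enc_in x))) (enc_out y) \<and>
        Sol x y)"

end

theory Submission
  imports Defs
begin

text \<open>With common indifference classes either no pair is acceptable or all are, and in the latter
  case a weakly stable matching is perfect. Call an acceptable pair \<open>(m, w)\<close> outside the matching
  unresolved if neither \<open>m\<close> nor \<open>w\<close> prefers the partner to the other already in \<open>I\<close>. For
  super-stability every such pair has to be interviewed, together with the matched pair of \<open>m\<close> or
  the matched pair of \<open>w\<close>, the latter being useful only if that agent does prefer the partner. This
  is a vertex cover problem on the matched pairs. If both choices are available, the two matched
  pairs agree in the classes of their men and of their women; conversely any two matched pairs that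
  agree in these classes are joined by an unresolved pair. So the problem splits into blocks that
  are complete graphs with some forced vertices, and an optimal cover leaves out one unforced
  vertex (here the first) of every block that has one.

  The resulting set of interviews is given by bounded quantifiers over the input bits. The
  machine program is compiled from expressions with bounded sums, each of which is
  evaluated in polynomial time.\<close>

section \<open>Covering unresolved pairs by interviews\<close>

section \<open>Which interviews are needed\<close>

text \<open>The common classes enter as ranks shared by all agents of a side. If man
  \<open>m\<close> and woman \<open>w\<close> are unresolved, then \<open>w\<close> ranks no worse
  than the partner of \<open>m\<close>, and \<open>m\<close> no worse than the partner of
  \<open>w\<close>. As the profile extends the class order, each choice available for this pair
  gives one of the two converse inequalities, so two available choices make the matched pairs agree
  in both ranks. With ranks that vary between agents, this agreement would hold only in the eyes of
  \<open>m\<close> and \<open>w\<close> and need not be transitive. Weak stability in the profile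
  says that every pair has at least one available choice.

  Optimality becomes a statement about sets of interviews, because super-stability translates into a
  condition on such a set alone.

  On the machine, a loop runs as often as the value of an expression says. Time and values are
  therefore bounded together, by a polynomial in a number that dominates the variables and the
  memory cells. The encoding needs products with \<open>n\<close> only, and these are sums.\<close>

definition unresolved :: "instance_data \<Rightarrow> (agent \<times> agent) set \<Rightarrow> agent \<Rightarrow> agent \<Rightarrow> bool" where
  "unresolved I \<mu> m w \<longleftrightarrow> (m, w) \<in> acc I \<and> (m, w) \<notin> \<mu> \<and>
     (\<forall>w'. (m, w') \<in> \<mu> \<longrightarrow> (w', w) \<notin> pref I m) \<and> (\<forall>m'. (m', w) \<in> \<mu> \<longrightarrow> (m', m) \<notin> pref I w)"

text \<open>Vertices of the cover problem are matched pairs, named by their men, and unresolved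
  pairs are the edges. A vertex is forced if some edge at it can be covered only there: the first
  disjunct is about edges at the man, the second about edges at his partner.\<close>

definition forced :: "instance_data \<Rightarrow> profile \<Rightarrow> (agent \<times> agent) set \<Rightarrow> agent \<Rightarrow> bool" where
  "forced I P \<mu> m \<longleftrightarrow>
     (\<exists>w. unresolved I \<mu> m w \<and> \<not> (\<exists>m'. (m', w) \<in> \<mu> \<and> (m', m) \<in> P w)) \<or>
     (\<exists>w. (m, w) \<in> \<mu> \<and> (\<exists>m'. unresolved I \<mu> m' w \<and> \<not> (\<exists>w'. (m', w') \<in> \<mu> \<and> (w', w) \<in> P m')))"

text \<open>The first unforced vertex of each block. Blocks need not be computed: an unresolved pair
  between two unforced vertices already places them in one block (\<open>unforced_block\<close>),
  and any two vertices of a block are joined.\<close>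

definition left_out :: "instance_data \<Rightarrow> profile \<Rightarrow> (agent \<times> agent) set \<Rightarrow> nat \<Rightarrow> bool" where
  "left_out I P \<mu> i \<longleftrightarrow> \<not> forced I P \<mu> (Man i) \<and>
     \<not> (\<exists>k<i. \<exists>w. (Man k, w) \<in> \<mu> \<and> \<not> forced I P \<mu> (Man k) \<and> unresolved I \<mu> (Man i) w)"

definition interviews ::
  "instance_data \<Rightarrow> profile \<Rightarrow> (agent \<times> agent) set \<Rightarrow> (agent \<times> agent) set" where
  "interviews I P \<mu> = {(m, w). unresolved I \<mu> m w} \<union>
     {(Man i, w) | i w. (Man i, w) \<in> \<mu> \<and> \<not> left_out I P \<mu> i}"

text \<open>The order that \<open>a\<close> learns has to be contained in \<open>P a\<close> and
  total on the interviewed candidates, so it can only be this restriction.\<close>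

definition interviewed :: "instance_data \<Rightarrow> profile \<Rightarrow> (agent \<times> agent) set \<Rightarrow> instance_data" where
  "interviewed I P T = I\<lparr>pref := \<lambda>a. pref I a \<union> (P a \<inter> opposite T a \<times> opposite T a)\<rparr>"

section \<open>What a set of interviews can yield, and its cost\<close>

lemma interviewed_simps [simp]:
  "num (interviewed I P T) = num I" "acc (interviewed I P T) = acc I"
  "pref (interviewed I P T) a = pref I a \<union> (P a \<inter> opposite T a \<times> opposite T a)"
  by (simp_all add: interviewed_def)

lemma agents_cong: "num I = num I' \<Longrightarrow> agents I = agents I'"
  by (simp add: agents_def men_def women_def)

lemma strict_total_orderD:
  assumes "strict_total_order_on A r"
  shows "r \<subseteq> A \<times> A" "trans r" "irrefl r" "total_on A r" "acyclic r"
  using assms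
  by (auto simp: strict_total_order_on_def strict_linear_order_on_def acyclic_irrefl)

lemma opposite_mono: "T \<subseteq> T' \<Longrightarrow> opposite T a \<subseteq> opposite T' a"
  by (auto simp: opposite_def)

text \<open>Acyclicity comes from the strict total order \<open>P a\<close>, which contains the
  known preferences as well as the new ones.\<close>

lemma interviews_yield_interviewed:
  assumes P: "strict_profile I P" and ref: "profile_refines P I" and T: "T \<subseteq> acc I"
  shows "interviews_yield I T (interviewed I P T)"
  unfolding interviews_yield_def
proof (intro conjI ballI)
  fix a assume a: "a \<in> agents I"
  let ?A = "opposite T a" let ?L = "P a \<inter> ?A \<times> ?A"
  have Pa: "strict_total_order_on (candidates I a) (P a)"
    using P a by (simp add: strict_profile_def)
  note Pa = strict_total_orderD[OF this]
  have "?A \<subseteq> candidates I a" using T by (rule opposite_mono)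
  then have "strict_total_order_on ?A ?L"
    using Pa(2,3,4) unfolding strict_total_order_on_def strict_linear_order_on_def
    by (auto simp: irrefl_def total_on_def trans_def) blast+
  moreover have "acyclic (pref (interviewed I P T) a)"
    using ref a by (intro acyclic_subset[OF Pa(5)]) (auto simp: profile_refines_def)
  ultimately show "\<exists>L. strict_total_order_on ?A L \<and>
      pref (interviewed I P T) a = pref I a \<union> L \<and> acyclic (pref (interviewed I P T) a)"
    by auto
qed (use T in auto)

text \<open>For the lower bound: a comparison that is new in \<open>I'\<close> agrees with
  \<open>P\<close> and requires interviews with both candidates compared.\<close>

lemma interviews_yield_subset:
  assumes "strict_profile I P" "profile_refines P I'" "interviews_yield I T I'" "a \<in> agents I"
  shows "pref I' a \<subseteq> pref I a \<union> (P a \<inter> opposite T a \<times> opposite T a)"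
proof -
  obtain L where L: "strict_total_order_on (opposite T a) L" "pref I' a = pref I a \<union> L"
    using assms by (auto simp: interviews_yield_def)
  have "agents I' = agents I" using assms by (intro agents_cong) (simp add: interviews_yield_def)
  then have "L \<subseteq> P a" using assms L by (auto simp: profile_refines_def)
  then show ?thesis using strict_total_orderD(1)[OF L(1)] L(2) by auto
qed

lemma cost_le:
  assumes "interviews_yield I T I'"
  shows "cost I I' \<le> card T"
  unfolding cost_def using assms by (intro Least_le) blast

lemma cost_attained:
  assumes "interview_compatible_refinement I I'"
  obtains T where "interviews_yield I T I'" "card T = cost I I'"
proof -
  have "\<exists>k T. interviews_yield I T I' \<and> card T = k"
    using assms by (auto simp: interview_compatible_refinement_def)
  then have "\<exists>T. interviews_yield I T I' \<and> card T = cost I I'"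
    unfolding cost_def by (rule LeastI_ex)
  then show thesis using that by blast
qed

section \<open>Optimality when all pairs are acceptable and the matching is perfect\<close>

text \<open>\<open>rw\<close> and \<open>rm\<close> are the class indices of the women and of the men; \<open>f\<close> maps men to
  their partners.\<close>

locale complete_instance =
  fixes I :: instance_data and P :: profile and \<mu> :: "(agent \<times> agent) set"
    and n :: nat and rw rm f :: "nat \<Rightarrow> nat"
  assumes n: "num I = n"
    and acc: "acc I = men I \<times> women I"
    and prefM: "\<And>i. i < n \<Longrightarrow> pref I (Man i) = {(Woman c, Woman d) | c d. c < n \<and> d < n \<and> rw c < rw d}"
    and prefW: "\<And>j. j < n \<Longrightarrow> pref I (Woman j) = {(Man c, Man d) | c d. c < n \<and> d < n \<and> rm c < rm d}"
    and profile: "strict_profile I P"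
    and refines: "profile_refines P I"
    and f: "bij_betw f {..<n} {..<n}"
    and \<mu>: "\<mu> = {(Man i, Woman (f i)) | i. i < n}"
    and stable: "weakly_stable (I\<lparr>pref := P\<rparr>) \<mu>"
begin

lemma f_lt: "i < n \<Longrightarrow> f i < n"
  using f by (auto dest: bij_betwE)

lemma f_eq_iff: "i < n \<Longrightarrow> k < n \<Longrightarrow> f i = f k \<longleftrightarrow> i = k"
  using f by (auto simp: bij_betw_def inj_on_def)

lemma f_onto: "j < n \<Longrightarrow> \<exists>i<n. f i = j"
  using f unfolding bij_betw_def by (metis imageE lessThan_iff)

text \<open>The women are named through their partners, as \<open>f\<close> is onto. A pair is then
  given by two indices of men, and it is matched iff these coincide.\<close>

lemma in_acc: "(m, w) \<in> acc I \<longleftrightarrow> (\<exists>i k. i < n \<and> k < n \<and> m = Man i \<and> w = Woman (f k))"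
  using f_onto f_lt by (fastforce simp: acc men_def women_def n)

lemma in_\<mu>: "(Man i, w) \<in> \<mu> \<longleftrightarrow> i < n \<and> w = Woman (f i)"
  "k < n \<Longrightarrow> (m, Woman (f k)) \<in> \<mu> \<longleftrightarrow> m = Man k"
  using f_eq_iff by (auto simp: \<mu>)

lemma in_acc_minus:
  "(m, w) \<in> acc I - \<mu> \<longleftrightarrow> (\<exists>i k. i < n \<and> k < n \<and> i \<noteq> k \<and> m = Man i \<and> w = Woman (f k))"
proof -
  have "(Man i, Woman (f k)) \<notin> \<mu> \<longleftrightarrow> i \<noteq> k" if "i < n" "k < n" for i k
    using that f_eq_iff by (auto simp: in_\<mu>(1))
  then show ?thesis unfolding Diff_iff in_acc by blast
qed

lemma agentsI: "i < n \<Longrightarrow> Man i \<in> agents I" "j < n \<Longrightarrow> Woman j \<in> agents I"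
  by (auto simp: agents_def men_def women_def n)

lemma candidates: "i < n \<Longrightarrow> candidates I (Man i) = Woman ` {..<n}"
  "j < n \<Longrightarrow> candidates I (Woman j) = Man ` {..<n}"
  by (auto simp: opposite_def acc men_def women_def n)

lemma opposite_\<mu>: "i < n \<Longrightarrow> opposite \<mu> (Man i) = {Woman (f i)}"
  "k < n \<Longrightarrow> opposite \<mu> (Woman (f k)) = {Man k}"
  using f_eq_iff by (auto simp: opposite_def \<mu>)

text \<open>Matched pairs are named by their men. The pair of man \<open>i\<close> and the partner of man \<open>k\<close> is
  decided in favour of stability by \<open>a i k\<close>, the preference of \<open>i\<close>, or \<open>b i k\<close>, that of the woman.\<close>

definition cross where "cross i k \<longleftrightarrow> i < n \<and> k < n \<and> i \<noteq> k \<and> rw (f k) \<le> rw (f i) \<and> rm i \<le> rm k"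
definition a where "a i k \<longleftrightarrow> (Woman (f i), Woman (f k)) \<in> P (Man i)"
definition b where "b i k \<longleftrightarrow> (Man k, Man i) \<in> P (Woman (f k))"

lemma P_orders:
  "i < n \<Longrightarrow> strict_total_order_on (Woman ` {..<n}) (P (Man i))"
  "j < n \<Longrightarrow> strict_total_order_on (Man ` {..<n}) (P (Woman j))"
  using profile agentsI candidates by (force simp: strict_profile_def)+

lemma P_asym:
  "ag \<in> agents I \<Longrightarrow> (c, d) \<in> P ag \<Longrightarrow> (d, c) \<notin> P ag"
  using profile unfolding strict_profile_def
  by (meson irrefl_def strict_total_orderD(2,3) transE)

lemma pref_P: "ag \<in> agents I \<Longrightarrow> pref I ag \<subseteq> P ag"
  using refines by (auto simp: profile_refines_def)

text \<open>A smaller rank of \<open>f k\<close> would be a strict preference already in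
  \<open>I\<close>, hence in \<open>P\<close>, which is asymmetric.\<close>

lemma a_rank:
  assumes "a i k" "i < n" "k < n" shows "rw (f i) \<le> rw (f k)"
proof (rule ccontr)
  assume "\<not> ?thesis"
  then have "(Woman (f k), Woman (f i)) \<in> pref I (Man i)" using assms f_lt by (simp add: prefM)
  then have "(Woman (f k), Woman (f i)) \<in> P (Man i)"
    using pref_P[OF agentsI(1)[OF assms(2)]] by blast
  then show False using P_asym[OF agentsI(1)[OF assms(2)]] assms(1) unfolding a_def by blast
qed

lemma b_rank:
  assumes "b i k" "i < n" "k < n" shows "rm k \<le> rm i"
proof (rule ccontr)
  assume "\<not> ?thesis"
  then have "(Man i, Man k) \<in> pref I (Woman (f k))" using assms f_lt by (simp add: prefW)
  then have "(Man i, Man k) \<in> P (Woman (f k))"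
    using pref_P[OF agentsI(2)[OF f_lt[OF assms(3)]]] by blast
  then show False using P_asym[OF agentsI(2)[OF f_lt[OF assms(3)]]] assms(1) unfolding b_def by blast
qed

text \<open>Weak stability is used here: by totality of the two orders, failure of both choices
  would make man \<open>i\<close> and the partner of \<open>k\<close> prefer each other.\<close>

lemma a_or_b:
  assumes "i < n" "k < n" "i \<noteq> k" shows "a i k \<or> b i k"
proof (rule ccontr)
  assume "\<not> ?thesis"
  then have "(Woman (f k), Woman (f i)) \<in> P (Man i)" "(Man i, Man k) \<in> P (Woman (f k))"
    using strict_total_orderD(4)[OF P_orders(1)[of i]] strict_total_orderD(4)[OF P_orders(2)[of "f k"]]
      assms f_lt f_eq_iff unfolding a_def b_def total_on_def by (metis agent.inject image_eqI lessThan_iff)+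
  moreover have "(Man i, Woman (f k)) \<in> acc I - \<mu>"
    using assms unfolding in_acc_minus by blast
  ultimately have "\<not> (prefers_to_partner (I\<lparr>pref := P\<rparr>) \<mu> (Man i) (Woman (f k)) \<and>
      prefers_to_partner (I\<lparr>pref := P\<rparr>) \<mu> (Woman (f k)) (Man i))"
    using stable by (auto simp: weakly_stable_def)
  then show False
    using assms \<open>(Woman (f k), Woman (f i)) \<in> P (Man i)\<close> \<open>(Man i, Man k) \<in> P (Woman (f k))\<close>
    by (simp add: prefers_to_partner_def opposite_\<mu>)
qed

lemma unresolved_iff: "unresolved I \<mu> m w \<longleftrightarrow> (\<exists>i k. cross i k \<and> m = Man i \<and> w = Woman (f k))"
proof
  assume u: "unresolved I \<mu> m w"
  then obtain i k where ik: "i < n" "k < n" "m = Man i" "w = Woman (f k)"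
    by (auto simp: unresolved_def in_acc)
  then have "cross i k"
    using u by (auto simp: unresolved_def cross_def in_\<mu> prefM prefW f_lt)
  then show "\<exists>i k. cross i k \<and> m = Man i \<and> w = Woman (f k)" using ik by blast
next
  assume "\<exists>i k. cross i k \<and> m = Man i \<and> w = Woman (f k)"
  then obtain i k where ik: "cross i k" "i < n" "k < n" "i \<noteq> k" "m = Man i" "w = Woman (f k)"
    by (auto simp: cross_def)
  then have "(m, w) \<in> acc I" by (auto simp: in_acc)
  then show "unresolved I \<mu> m w"
    using ik f_eq_iff[of k i] by (auto simp: unresolved_def cross_def in_\<mu> prefM prefW f_lt)
qed

lemma unresolved_cross: "k < n \<Longrightarrow> unresolved I \<mu> (Man i) (Woman (f k)) \<longleftrightarrow> cross i k"
  using f_eq_iff by (auto simp: unresolved_iff cross_def)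

definition fo where "fo i \<longleftrightarrow> (\<exists>k. cross i k \<and> \<not> b i k) \<or> (\<exists>k. cross k i \<and> \<not> a k i)"

lemma forced_iff:
  assumes "i < n" shows "forced I P \<mu> (Man i) \<longleftrightarrow> fo i"
proof -
  have "(\<exists>w. unresolved I \<mu> (Man i) w \<and> \<not> (\<exists>m'. (m', w) \<in> \<mu> \<and> (m', Man i) \<in> P w)) \<longleftrightarrow>
      (\<exists>k. cross i k \<and> \<not> b i k)"
  proof -
    have "\<not> (\<exists>m'. (m', Woman (f k)) \<in> \<mu> \<and> (m', Man i) \<in> P (Woman (f k))) \<longleftrightarrow> \<not> b i k"
      if "cross i k" for k
      using that by (auto simp: in_\<mu> cross_def b_def)
    then show ?thesis unfolding unresolved_iff by blast
  qed
  moreover have "(\<exists>w. (Man i, w) \<in> \<mu> \<and> (\<exists>m'. unresolved I \<mu> m' w \<and>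
      \<not> (\<exists>w'. (m', w') \<in> \<mu> \<and> (w', w) \<in> P m'))) \<longleftrightarrow> (\<exists>k. cross k i \<and> \<not> a k i)"
  proof -
    have "\<not> (\<exists>w'. (Man k, w') \<in> \<mu> \<and> (w', Woman (f i)) \<in> P (Man k)) \<longleftrightarrow> \<not> a k i"
      if "cross k i" for k
      using that by (auto simp: in_\<mu> cross_def a_def)
    moreover have "unresolved I \<mu> m (Woman (f i)) \<longleftrightarrow> (\<exists>k. cross k i \<and> m = Man k)" for m
      using assms f_eq_iff unfolding unresolved_iff cross_def by auto
    moreover have "(Man i, w) \<in> \<mu> \<longleftrightarrow> w = Woman (f i)" for w
      using assms by (simp add: in_\<mu>(1))
    ultimately show ?thesis by metis
  qed
  ultimately show ?thesis unfolding forced_def fo_def by blast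
qed

definition lo where "lo i \<longleftrightarrow> \<not> fo i \<and> \<not> (\<exists>k<i. \<not> fo k \<and> cross i k)"

lemma left_out_iff:
  assumes "i < n" shows "left_out I P \<mu> i \<longleftrightarrow> lo i"
proof -
  have "(\<exists>w. (Man k, w) \<in> \<mu> \<and> \<not> forced I P \<mu> (Man k) \<and> unresolved I \<mu> (Man i) w) \<longleftrightarrow>
      \<not> fo k \<and> cross i k" if "k < i" for k
    using assms that by (auto simp: in_\<mu> forced_iff unresolved_cross)
  then show ?thesis unfolding left_out_def lo_def by (auto simp: forced_iff assms)
qed

text \<open>If neither end is forced, both choices are available, and their rank inequalities are
  converse to the two in \<open>cross\<close>.\<close>

lemma unforced_block:
  assumes "\<not> fo i" "\<not> fo k" "cross i k"
  shows "rw (f i) = rw (f k)" "rm i = rm k"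
proof -
  have "b i k" "a i k" using assms by (auto simp: fo_def)
  then show "rw (f i) = rw (f k)" "rm i = rm k"
    using a_rank[of i k] b_rank[of i k] assms(3) by (simp_all add: cross_def)
qed

lemma interviews_eq: "interviews I P \<mu> = {(Man i, Woman (f k)) | i k. cross i k} \<union>
    {(Man i, Woman (f i)) | i. i < n \<and> \<not> lo i}"
  unfolding interviews_def unresolved_iff by (auto simp: in_\<mu> left_out_iff)

text \<open>Super-stability after the interviews \<open>T\<close>, expressed by \<open>T\<close>
  alone. The matched pair at an end helps only if that end prefers the partner in \<open>P\<close>,
  as interviews merely reveal \<open>P\<close>.\<close>

definition resolves where
  "resolves T \<longleftrightarrow> (\<forall>i k. cross i k \<longrightarrow> (Man i, Woman (f k)) \<in> T \<and>
     ((a i k \<and> (Man i, Woman (f i)) \<in> T) \<or> (b i k \<and> (Man k, Woman (f k)) \<in> T)))"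

lemma resolvesD:
  assumes "resolves T" "cross i k"
  shows "(Man i, Woman (f k)) \<in> T"
    "(a i k \<and> (Man i, Woman (f i)) \<in> T) \<or> (b i k \<and> (Man k, Woman (f k)) \<in> T)"
  using assms unfolding resolves_def by simp_all

lemma resolves_interviews: "resolves (interviews I P \<mu>)"
  unfolding resolves_def
proof (intro allI impI conjI)
  fix i k assume c: "cross i k"
  then have ik: "i < n" "k < n" "i \<noteq> k" by (auto simp: cross_def)
  show "(Man i, Woman (f k)) \<in> interviews I P \<mu>" using c by (auto simp: interviews_eq)
  \<comment> \<open>If neither end serves, an available choice puts its end into \<open>lo\<close>.
    That end is then unforced, which makes the other choice available as well. So both are left out,
    although only one can come first in their block.\<close>
  have "a i k \<and> \<not> lo i \<or> b i k \<and> \<not> lo k"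
  proof (rule ccontr)
    assume *: "\<not> ?thesis"
    then have un: "\<not> fo i" "\<not> fo k"
      using a_or_b[OF ik] c by (auto simp: fo_def lo_def)
    have eq: "rw (f i) = rw (f k)" "rm i = rm k" using unforced_block[OF un c] .
    have "a i k" "b i k" using un c by (auto simp: fo_def)
    with * have lo: "lo i" "lo k" by auto
    have "cross k i" using c eq by (auto simp: cross_def)
    with lo c un ik show False unfolding lo_def by (metis linorder_neqE_nat)
  qed
  then show "(a i k \<and> (Man i, Woman (f i)) \<in> interviews I P \<mu>) \<or>
      (b i k \<and> (Man k, Woman (f k)) \<in> interviews I P \<mu>)"
    using ik by (auto simp: interviews_eq)
qed

lemma interviews_subset: "interviews I P \<mu> \<subseteq> acc I"
  using in_acc unfolding interviews_eq cross_def by blast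

text \<open>Everyone has a partner, and \<open>pref I'\<close> inherits asymmetry from
  \<open>P\<close>. Hence preferring the other agent or being unable to compare amounts to not
  preferring the partner.\<close>

lemma super_stable_iff:
  assumes "num I' = n" "acc I' = acc I" "profile_refines P I'"
  shows "super_stable I' \<mu> \<longleftrightarrow> (\<forall>i k. i < n \<longrightarrow> k < n \<longrightarrow> i \<noteq> k \<longrightarrow>
    (Woman (f i), Woman (f k)) \<in> pref I' (Man i) \<or> (Man k, Man i) \<in> pref I' (Woman (f k)))"
proof -
  have ag: "agents I' = agents I" using assms n by (intro agents_cong) simp
  have asym: "(d, c) \<notin> pref I' x" if x: "x \<in> agents I" and "(c, d) \<in> pref I' x" for x c d
  proof -
    have "pref I' x \<subseteq> P x" using assms(3) x ag by (auto simp: profile_refines_def)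
    then show ?thesis using P_asym[OF x, of c d] that(2) by blast
  qed
  have 1: "(prefers_to_partner I' \<mu> (Man i) (Woman (f k)) \<or>
      incomparable_to_partner I' \<mu> (Man i) (Woman (f k))) \<longleftrightarrow>
      (Woman (f i), Woman (f k)) \<notin> pref I' (Man i)" if "i < n" "k < n" "i \<noteq> k" for i k
    using that asym[OF agentsI(1)[OF that(1)], of "Woman (f i)" "Woman (f k)"] f_eq_iff[OF that(1,2)]
    by (auto simp: prefers_to_partner_def incomparable_to_partner_def incomparable_def opposite_\<mu>)
  have 2: "(prefers_to_partner I' \<mu> (Woman (f k)) (Man i) \<or>
      incomparable_to_partner I' \<mu> (Woman (f k)) (Man i)) \<longleftrightarrow>
      (Man k, Man i) \<notin> pref I' (Woman (f k))" if "i < n" "k < n" "i \<noteq> k" for i k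
    using that asym[OF agentsI(2)[OF f_lt[OF that(2)]], of "Man k" "Man i"]
    by (auto simp: prefers_to_partner_def incomparable_to_partner_def incomparable_def opposite_\<mu>)
  have "very_weak_blocking_pair I' \<mu> (Man i) (Woman (f k)) \<longleftrightarrow>
      (Woman (f i), Woman (f k)) \<notin> pref I' (Man i) \<and> (Man k, Man i) \<notin> pref I' (Woman (f k))"
    if ik: "i < n" "k < n" "i \<noteq> k" for i k
  proof -
    have "(Man i, Woman (f k)) \<in> acc I - \<mu>" using ik unfolding in_acc_minus by blast
    then show ?thesis unfolding very_weak_blocking_pair_def assms(2) 1[OF ik] 2[OF ik] by simp
  qed
  moreover have "\<exists>i k. i < n \<and> k < n \<and> i \<noteq> k \<and> m = Man i \<and> w = Woman (f k)"
    if "very_weak_blocking_pair I' \<mu> m w" for m w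
    using that unfolding very_weak_blocking_pair_def assms(2) in_acc_minus by blast
  ultimately show ?thesis unfolding super_stable_def by blast
qed

lemma resolves_super_stable:
  assumes "T \<subseteq> acc I" "resolves T"
  shows "profile_refines P (interviewed I P T)" "super_stable (interviewed I P T) \<mu>"
proof -
  have "agents (interviewed I P T) = agents I" by (rule agents_cong) simp
  then show ref: "profile_refines P (interviewed I P T)"
    using refines by (auto simp: profile_refines_def)
  have "(Woman (f i), Woman (f k)) \<in> pref (interviewed I P T) (Man i) \<or>
      (Man k, Man i) \<in> pref (interviewed I P T) (Woman (f k))"
    if ik: "i < n" "k < n" "i \<noteq> k" for i k
  proof (cases "cross i k")
    case True
    note res = resolvesD[OF assms(2) True]
    have "Woman (f k) \<in> opposite T (Man i)" "Man i \<in> opposite T (Woman (f k))"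
      using res(1) by (simp_all add: opposite_def)
    moreover have "a i k \<and> Woman (f i) \<in> opposite T (Man i) \<or> b i k \<and> Man k \<in> opposite T (Woman (f k))"
      using res(2) by (auto simp: opposite_def)
    ultimately show ?thesis by (auto simp: a_def b_def)
  next
    case False
    then have "rw (f i) < rw (f k) \<or> rm k < rm i" using ik by (auto simp: cross_def)
    then have "(Woman (f i), Woman (f k)) \<in> pref I (Man i) \<or> (Man k, Man i) \<in> pref I (Woman (f k))"
      using ik f_lt by (simp add: prefM prefW)
    then show ?thesis by auto
  qed
  moreover have "num (interviewed I P T) = n" "acc (interviewed I P T) = acc I" by (simp_all add: n)
  ultimately show "super_stable (interviewed I P T) \<mu>"
    using super_stable_iff[OF _ _ ref] by blast
qed

text \<open>\<open>I\<close> itself does not settle an unresolved pair, so one of its agents has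
  acquired a comparison of the partner with the other. By \<open>interviews_yield_subset\<close>
  both of these interviews belong to \<open>T\<close>.\<close>

lemma super_stable_resolves:
  assumes y: "interviews_yield I T I'" and ref: "profile_refines P I'" and st: "super_stable I' \<mu>"
  shows "resolves T"
  unfolding resolves_def
proof (intro allI impI)
  fix i k assume c: "cross i k"
  then have ik: "i < n" "k < n" "i \<noteq> k" by (auto simp: cross_def)
  have "num I' = n" "acc I' = acc I" "T \<subseteq> acc I" using y n by (auto simp: interviews_yield_def)
  then have in_pref:
    "(Woman (f i), Woman (f k)) \<in> pref I' (Man i) \<or> (Man k, Man i) \<in> pref I' (Woman (f k))"
    using st super_stable_iff[OF _ _ ref] ik by blast
  have no: "(Woman (f i), Woman (f k)) \<notin> pref I (Man i)" "(Man k, Man i) \<notin> pref I (Woman (f k))"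
    using c f_lt by (auto simp: cross_def prefM prefW)
  have "Woman j \<in> opposite T (Man l) \<longleftrightarrow> (Man l, Woman j) \<in> T"
    "Man l \<in> opposite T (Woman j) \<longleftrightarrow> (Man l, Woman j) \<in> T" for j l
    using \<open>T \<subseteq> acc I\<close> by (auto simp: opposite_def in_acc)
  note opp = this
  have "a i k \<and> (Man i, Woman (f i)) \<in> T \<and> (Man i, Woman (f k)) \<in> T"
    if "(Woman (f i), Woman (f k)) \<in> pref I' (Man i)"
    using subsetD[OF interviews_yield_subset[OF profile ref y agentsI(1)[OF ik(1)]] that] no opp
    by (simp add: a_def)
  moreover have "b i k \<and> (Man k, Woman (f k)) \<in> T \<and> (Man i, Woman (f k)) \<in> T"
    if "(Man k, Man i) \<in> pref I' (Woman (f k))"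
    using subsetD[OF interviews_yield_subset[OF profile ref y agentsI(2)[OF f_lt[OF ik(2)]]] that] no opp
    by (simp add: b_def)
  ultimately show "(Man i, Woman (f k)) \<in> T \<and>
     ((a i k \<and> (Man i, Woman (f i)) \<in> T) \<or> (b i k \<and> (Man k, Woman (f k)) \<in> T))"
    using in_pref by blast
qed

text \<open>Each matched pair missing in \<open>T\<close> is unforced, and two of them are never in the same
  block. So mapping it to the first unforced pair of its block is injective, with left out pairs
  as values.\<close>

lemma resolves_card:
  assumes T: "T \<subseteq> acc I" "resolves T"
  shows "card (interviews I P \<mu>) \<le> card T"
proof -
  define X where "X = {i. i < n \<and> (Man i, Woman (f i)) \<notin> T}"
  define Y where "Y = {i. i < n \<and> lo i}"
  define U where "U = {(Man i, Woman (f k)) | i k. cross i k}"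
  define D where "D = (\<lambda>i. (Man i, Woman (f i)))"
  have X: "\<not> fo i" if "i \<in> X" for i
  proof
    assume "fo i"
    then obtain k where "cross i k \<and> \<not> b i k \<or> cross k i \<and> \<not> a k i" by (auto simp: fo_def)
    then show False
      using that resolvesD(2)[OF T(2), of i k] resolvesD(2)[OF T(2), of k i] by (auto simp: X_def)
  qed
  have XX: "\<not> cross i k" if "i \<in> X" "k \<in> X" for i k
    using that resolvesD(2)[OF T(2), of i k] by (auto simp: X_def)
  \<comment> \<open>\<open>cross\<close> excludes \<open>i = k\<close>, whereas the block of
    \<open>i\<close> must contain \<open>i\<close> itself; so the block is described by
    ranks.\<close>
  define blk where "blk = (\<lambda>i k. k < n \<and> \<not> fo k \<and> rw (f k) = rw (f i) \<and> rm k = rm i)"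
  define g where "g = (\<lambda>i. LEAST k. blk i k)"
  have g: "blk i (g i)" if "i \<in> X" for i
  proof -
    have "blk i i" using that X by (auto simp: blk_def X_def)
    then show ?thesis unfolding g_def by (rule LeastI)
  qed
  have gl: "g i \<le> k" if "blk i k" for i k
    unfolding g_def using that by (rule Least_le)
  have "inj_on g X"
  proof (rule inj_onI, rule ccontr)
    fix i k assume ik: "i \<in> X" "k \<in> X" "g i = g k" "i \<noteq> k"
    have "rw (f i) = rw (f k)" "rm i = rm k"
      using g[OF ik(1)] g[OF ik(2)] ik(3) by (auto simp: blk_def)
    then have "cross i k" using ik by (auto simp: cross_def X_def)
    then show False using XX ik by blast
  qed
  moreover have "g ` X \<subseteq> Y"
  proof
    fix y assume "y \<in> g ` X"
    then obtain i where i: "i \<in> X" "y = g i" by auto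
    have y: "blk i y" using g i by simp
    have "\<not> (\<not> fo k \<and> cross y k)" if "k < y" for k
    proof
      assume *: "\<not> fo k \<and> cross y k"
      then have "blk i k" using unforced_block[of y k] y by (auto simp: blk_def cross_def)
      then show False using gl i that by fastforce
    qed
    then show "y \<in> Y" using y by (auto simp: Y_def lo_def blk_def)
  qed
  ultimately have XY: "card X \<le> card Y"
    by (intro card_inj_on_le) (auto simp: Y_def)
  have finU: "finite U"
  proof (rule finite_subset)
    show "U \<subseteq> (\<lambda>(i, k). (Man i, Woman (f k))) ` ({..<n} \<times> {..<n})" by (auto simp: U_def cross_def)
  qed simp
  have injD: "inj_on D S" for S by (auto simp: D_def inj_on_def)
  have UD: "U \<inter> D ` S = {}" for S
    using f_eq_iff by (auto simp: U_def D_def cross_def)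
  have XYn: "X \<subseteq> {..<n}" "Y \<subseteq> {..<n}" by (auto simp: X_def Y_def)
  \<comment> \<open>The interviews in \<open>U\<close> belong to every resolving set, so only
    matched pairs make a difference, and these are counted through the missing ones.\<close>
  have "interviews I P \<mu> = U \<union> D ` ({..<n} - Y)"
    by (auto simp: interviews_eq U_def D_def Y_def)
  then have "card (interviews I P \<mu>) = card U + card (D ` ({..<n} - Y))"
    using finU UD by (simp add: card_Un_disjoint)
  also have "card (D ` ({..<n} - Y)) = n - card Y"
    using XYn by (simp add: card_image injD card_Diff_subset finite_subset[of _ "{..<n}"])
  also have "card U + (n - card Y) \<le> card U + (n - card X)" using XY by simp
  also have "n - card X = card (D ` ({..<n} - X))"
    using XYn by (simp add: card_image injD card_Diff_subset finite_subset[of _ "{..<n}"])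
  also have "card U + card (D ` ({..<n} - X)) = card (U \<union> D ` ({..<n} - X))"
    using finU UD by (simp add: card_Un_disjoint)
  also have "\<dots> \<le> card T"
  proof (rule card_mono)
    have "acc I = Man ` {..<n} \<times> Woman ` {..<n}" by (simp add: acc men_def women_def n)
    then show "finite T" using T(1) finite_subset by fastforce
    show "U \<union> D ` ({..<n} - X) \<subseteq> T"
      using resolvesD(1)[OF T(2)] by (auto simp: U_def D_def X_def)
  qed
  finally show ?thesis .
qed

text \<open>An upper bound by \<open>card\<close> suffices for the cost of the constructed
  refinement, because each competitor is represented by a set that attains its cost.\<close>

lemma solution: "min_ICR_exact_solution (I, P, \<mu>) (interviewed I P (interviews I P \<mu>))"
proof -
  let ?T = "interviews I P \<mu>"
  have y: "interviews_yield I ?T (interviewed I P ?T)"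
    by (rule interviews_yield_interviewed[OF profile refines interviews_subset])
  have "cost I (interviewed I P ?T) \<le> cost I I''" if "ICR_exact_feasible (I, P, \<mu>) I''" for I''
  proof -
    have I'': "interview_compatible_refinement I I''" "profile_refines P I''" "super_stable I'' \<mu>"
      using that by auto
    obtain T where T: "interviews_yield I T I''" "card T = cost I I''"
      using cost_attained[OF I''(1)] .
    have "resolves T" using super_stable_resolves[OF T(1) I''(2,3)] .
    moreover have "T \<subseteq> acc I" using T(1) by (auto simp: interviews_yield_def)
    ultimately have "card ?T \<le> card T" by (rule resolves_card[rotated])
    then show ?thesis using cost_le[OF y] T(2) by simp
  qed
  then show ?thesis
    using y resolves_super_stable[OF interviews_subset resolves_interviews]
    by (auto simp: interview_compatible_refinement_def)
qed

end

section \<open>From common classes to ranks and a perfect matching\<close>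

lemma rank_of_classes:
  assumes cand: "\<And>a. a \<in> A \<Longrightarrow> candidates I a = F ` {..<num I}"
    and cl: "\<And>a. a \<in> A \<Longrightarrow> indifference_classes I a (C a)"
    and common: "\<And>a b i. a \<in> A \<Longrightarrow> b \<in> A \<Longrightarrow> i \<in> {1..num I} \<Longrightarrow> C a i = C b i"
  shows "\<exists>r :: nat \<Rightarrow> nat. \<forall>a\<in>A. pref I a =
    {(F c, F d) | c d. c < num I \<and> d < num I \<and> r c < r d}"
proof (cases "A = {}")
  case False
  then obtain a0 where a0: "a0 \<in> A" by blast
  note c0 = cl[OF a0, unfolded indifference_classes_def]
  have un: "(\<Union>t\<in>{1..num I}. C a0 t) = F ` {..<num I}"
    using conjunct1[OF c0] cand[OF a0] by (rule trans)
  have disj: "\<forall>s\<in>{1..num I}. \<forall>t\<in>{1..num I}. s \<noteq> t \<longrightarrow> C a0 s \<inter> C a0 t = {}"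
    using c0 by (elim conjE)
  have "\<exists>t. t \<in> {1..num I} \<and> F c \<in> C a0 t" if "c < num I" for c
    using un that by blast
  \<comment> \<open>The classes are common, so the index of a candidate may be read off from the
    single agent \<open>a0\<close>.\<close>
  then obtain r where r: "\<And>c. c < num I \<Longrightarrow> r c \<in> {1..num I} \<and> F c \<in> C a0 (r c)"
    by metis
  have r_eq: "t = r c" if "t \<in> {1..num I}" "F c \<in> C a0 t" "c < num I" for t c
    using bspec[OF bspec[OF disj that(1)], of "r c"] r[OF that(3)] that(2) by blast
  have "pref I a = {(F c, F d) | c d. c < num I \<and> d < num I \<and> r c < r d}" if a: "a \<in> A" for a
  proof -
    have "pref I a = {(c, d). \<exists>s\<in>{1..num I}. \<exists>t\<in>{1..num I}. s < t \<and> c \<in> C a s \<and> d \<in> C a t}"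
      using cl[OF a] unfolding indifference_classes_def by (elim conjE)
    also have "\<dots> = {(c, d). \<exists>s\<in>{1..num I}. \<exists>t\<in>{1..num I}. s < t \<and> c \<in> C a0 s \<and> d \<in> C a0 t}"
    proof -
      have "(\<exists>s\<in>{1..num I}. \<exists>t\<in>{1..num I}. s < t \<and> c \<in> C a s \<and> d \<in> C a t) \<longleftrightarrow>
          (\<exists>s\<in>{1..num I}. \<exists>t\<in>{1..num I}. s < t \<and> c \<in> C a0 s \<and> d \<in> C a0 t)" for c d
        by (intro bex_cong refl) (simp only: common[OF a a0])
      then show ?thesis by (simp only:)
    qed
    also have "\<dots> = {(F c, F d) | c d. c < num I \<and> d < num I \<and> r c < r d}" (is "?X = ?Y")
    proof (intro equalityI subsetI)
      fix p assume "p \<in> ?X"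
      then obtain x y s t where p: "p = (x, y)" "s \<in> {1..num I}" "t \<in> {1..num I}" "s < t"
        "x \<in> C a0 s" "y \<in> C a0 t" by blast
      then have "x \<in> F ` {..<num I}" "y \<in> F ` {..<num I}" using un by blast+
      then obtain c d where "x = F c" "y = F d" "c < num I" "d < num I" by blast
      moreover from this have "s = r c" "t = r d" using r_eq p by blast+
      ultimately show "p \<in> ?Y" using p by blast
    next
      fix p assume "p \<in> ?Y"
      then show "p \<in> ?X" using r by blast
    qed
    finally show ?thesis .
  qed
  then show ?thesis by blast
qed simp

text \<open>The classes of an agent exhaust the candidates, so all agents of a side have equal
  candidate sets, and one acceptable pair \<open>(m0, w0)\<close> yields \<open>(m, w0)\<close> and
  from it every \<open>(m, w)\<close>. By counting, an unmatched man entails an unmatched woman, and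
  these two would block.\<close>

lemma common_classes_cases:
  assumes inp: "min_ICR_exact_input (I, P, \<mu>)" and cc: "SMTI_common_classes I"
  shows "acc I = {} \<or> (\<exists>rw rm f. complete_instance I P \<mu> (num I) rw rm f)"
proof (cases "acc I = {}")
  case False
  define n where "n = num I"
  have sub: "acc I \<subseteq> men I \<times> women I" and mat: "matching I \<mu>"
    and prof: "strict_profile I P" "profile_refines P I" and st: "weakly_stable (I\<lparr>pref := P\<rparr>) \<mu>"
    using inp by (auto simp: SMPI_def)
  obtain C where C: "\<And>a. a \<in> agents I \<Longrightarrow> indifference_classes I a (C a)"
    "\<And>m m' i. m \<in> men I \<Longrightarrow> m' \<in> men I \<Longrightarrow> i \<in> {1..num I} \<Longrightarrow> C m i = C m' i"
    "\<And>w w' i. w \<in> women I \<Longrightarrow> w' \<in> women I \<Longrightarrow> i \<in> {1..num I} \<Longrightarrow> C w i = C w' i"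
    using cc unfolding SMTI_common_classes_def by metis
  have cand_C: "candidates I a = (\<Union>t\<in>{1..num I}. C a t)" if "a \<in> agents I" for a
    using C(1)[OF that] unfolding indifference_classes_def by simp
  have candM: "candidates I m = candidates I m'" if "m \<in> men I" "m' \<in> men I" for m m'
  proof -
    have "(\<Union>t\<in>{1..num I}. C m t) = (\<Union>t\<in>{1..num I}. C m' t)"
      by (rule SUP_cong[OF refl C(2)[OF that]])
    then show ?thesis using cand_C that by (simp add: agents_def)
  qed
  have candW: "candidates I w = candidates I w'" if "w \<in> women I" "w' \<in> women I" for w w'
  proof -
    have "(\<Union>t\<in>{1..num I}. C w t) = (\<Union>t\<in>{1..num I}. C w' t)"
      by (rule SUP_cong[OF refl C(3)[OF that]])
    then show ?thesis using cand_C that by (simp add: agents_def)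
  qed
  have opp: "w \<in> candidates I m \<longleftrightarrow> (m, w) \<in> acc I" "m \<in> candidates I w \<longleftrightarrow> (m, w) \<in> acc I"
    if "m \<in> men I" "w \<in> women I" for m w
    using sub that by (auto simp: opposite_def men_def women_def)
  obtain m0 w0 where mw: "(m0, w0) \<in> acc I" "m0 \<in> men I" "w0 \<in> women I" using False sub by auto
  have acc: "acc I = men I \<times> women I"
  proof (intro equalityI sub subsetI)
    fix p assume "p \<in> men I \<times> women I"
    then obtain m w where p: "p = (m, w)" "m \<in> men I" "w \<in> women I" by blast
    have "(m, w0) \<in> acc I" using opp(1) candM mw p by blast
    then have "(m, w) \<in> acc I" using opp(2) candW mw p by blast
    then show "p \<in> acc I" using p by simp
  qed
  have cM: "candidates I m = Woman ` {..<num I}" if "m \<in> men I" for m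
    using that by (auto simp: opposite_def acc men_def women_def)
  have cW: "candidates I w = Man ` {..<num I}" if "w \<in> women I" for w
    using that by (auto simp: opposite_def acc men_def women_def)
  obtain rw :: "nat \<Rightarrow> nat" where rw: "\<forall>a\<in>men I. pref I a =
      {(Woman c, Woman d) | c d. c < num I \<and> d < num I \<and> rw c < rw d}"
    using rank_of_classes[of "men I" I Woman C, OF cM C(1) C(2)] by (auto simp: agents_def)
  obtain rm :: "nat \<Rightarrow> nat" where rm: "\<forall>a\<in>women I. pref I a =
      {(Man c, Man d) | c d. c < num I \<and> d < num I \<and> rm c < rm d}"
    using rank_of_classes[of "women I" I Man C, OF cW C(1) C(3)] by (auto simp: agents_def)
  have \<mu>sub: "\<mu> \<subseteq> men I \<times> women I" using mat sub by (auto simp: matching_def)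
  have uniqM: "w = w'" if "(m, w) \<in> \<mu>" "(m, w') \<in> \<mu>" for m w w'
    using mat that \<mu>sub unfolding matching_def agents_def opposite_def by blast
  have uniqW: "m = m'" if "(m, w) \<in> \<mu>" "(m', w) \<in> \<mu>" for m m' w
    using mat that \<mu>sub unfolding matching_def agents_def opposite_def by blast
  define S where "S = {i. i < n \<and> (\<exists>j. (Man i, Woman j) \<in> \<mu>)}"
  have "\<forall>i\<in>S. \<exists>j. (Man i, Woman j) \<in> \<mu>" by (auto simp: S_def)
  then obtain f where f: "\<And>i. i \<in> S \<Longrightarrow> (Man i, Woman (f i)) \<in> \<mu>" by metis
  have f_lt: "f i < n" if "i \<in> S" for i
    using f[OF that] \<mu>sub by (auto simp: women_def n_def)
  have inj: "inj_on f S"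
    using f uniqW by (metis agent.inject(1) inj_onI)
  have "S = {..<n}"
  proof (rule ccontr)
    assume "S \<noteq> {..<n}"
    moreover have S: "S \<subseteq> {..<n}" by (auto simp: S_def)
    ultimately have "card S < n" using psubset_card_mono[of "{..<n}" S] by auto
    then have "card (f ` S) < card {..<n}" using inj by (simp add: card_image)
    then obtain j where j: "j < n" "j \<notin> f ` S"
      using f_lt by (metis card_mono finite_imageI finite_subset S finite_lessThan lessThan_iff linorder_not_less subsetI)
    obtain i where i: "i < n" "i \<notin> S" using \<open>S \<noteq> {..<n}\<close> S by blast
    have i': "(Man i, w) \<notin> \<mu>" "(w, Man i) \<notin> \<mu>" for w
      using i \<mu>sub by (auto simp: S_def women_def men_def)
    have j': "(m, Woman j) \<notin> \<mu>" "(Woman j, m) \<notin> \<mu>" for m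
    proof
      assume m: "(m, Woman j) \<in> \<mu>"
      then obtain k where k: "m = Man k" "k < n" using \<mu>sub by (auto simp: men_def n_def)
      then have "k \<in> S" using m by (auto simp: S_def)
      then have "f k = j" using f[of k] uniqM m k by blast
      then show False using j \<open>k \<in> S\<close> by blast
    qed (use \<mu>sub in \<open>auto simp: men_def\<close>)
    have "opposite \<mu> (Man i) = {}" "opposite \<mu> (Woman j) = {}"
      using i' j' by (auto simp: opposite_def)
    moreover have "(Man i, Woman j) \<in> acc I - \<mu>"
      using i j i' by (auto simp: acc men_def women_def n_def)
    ultimately show False using st by (auto simp: weakly_stable_def prefers_to_partner_def)
  qed
  then have "f ` {..<n} = {..<n}"
    using inj f_lt by (intro endo_inj_surj) auto
  then have bij: "bij_betw f {..<n} {..<n}" using inj \<open>S = {..<n}\<close> by (simp add: bij_betw_def)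
  have \<mu>: "\<mu> = {(Man i, Woman (f i)) | i. i < n}"
  proof (intro equalityI subsetI)
    fix p assume p: "p \<in> \<mu>"
    then obtain i w where "p = (Man i, w)" "i < n" using \<mu>sub by (auto simp: men_def n_def)
    moreover from this have "w = Woman (f i)" using f[of i] p uniqM \<open>S = {..<n}\<close> by blast
    ultimately show "p \<in> {(Man i, Woman (f i)) | i. i < n}" by blast
  next
    fix p assume "p \<in> {(Man i, Woman (f i)) | i. i < n}"
    then show "p \<in> \<mu>" using f \<open>S = {..<n}\<close> by auto
  qed
  have "complete_instance I P \<mu> n rw rm f"
  proof
    show "num I = n" by (simp add: n_def)
    show "pref I (Man i) = {(Woman c, Woman d) | c d. c < n \<and> d < n \<and> rw c < rw d}" if "i < n" for i
      using rw that by (simp add: men_def n_def)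
    show "pref I (Woman j) = {(Man c, Man d) | c d. c < n \<and> d < n \<and> rm c < rm d}" if "j < n" for j
      using rm that by (simp add: women_def n_def)
  qed (fact acc prof bij \<mu> st)+
  then show ?thesis unfolding n_def by blast
qed simp

lemma min_ICR_exact_solution_interviewed:
  assumes inp: "min_ICR_exact_input (I, P, \<mu>)" and cc: "SMTI_common_classes I"
  shows "min_ICR_exact_solution (I, P, \<mu>) (interviewed I P (interviews I P \<mu>))"
  using common_classes_cases[OF assms]
proof
  assume acc: "acc I = {}"
  have "\<mu> = {}" using inp acc by (simp add: matching_def)
  then have T: "interviews I P \<mu> = {}" using acc by (auto simp: interviews_def unresolved_def)
  let ?I = "interviewed I P {}"
  have prof: "strict_profile I P" "profile_refines P I" using inp by auto
  have y: "interviews_yield I {} ?I"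
    by (rule interviews_yield_interviewed[OF prof]) simp
  have "cost I ?I = 0" using cost_le[OF y] by simp
  moreover have "super_stable ?I \<mu>"
    using acc by (simp add: super_stable_def very_weak_blocking_pair_def)
  moreover have "profile_refines P ?I"
    using prof(2) agents_cong[of ?I I] by (simp add: profile_refines_def)
  ultimately show ?thesis unfolding T using y by (auto simp: interview_compatible_refinement_def)
next
  assume "\<exists>rw rm f. complete_instance I P \<mu> (num I) rw rm f"
  then show ?thesis using complete_instance.solution by blast
qed

section \<open>Step-bounded runs, code placement and counting loops\<close>

section \<open>Runs of the machine\<close>

text \<open>\<open>T\<close> is only an upper bound, so runs whose length depends on the data
  compose without exact step counts.\<close>

definition reach :: "instr list \<Rightarrow> nat \<Rightarrow> config \<Rightarrow> config \<Rightarrow> bool" where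
  "reach prog T c c' \<longleftrightarrow> (\<exists>t\<le>T. (step prog ^^ t) c = c')"

lemma reach_refl: "reach prog T c c"
  unfolding reach_def by (rule exI[of _ 0]) simp

lemma reach_mono: "reach prog T c c' \<Longrightarrow> T \<le> T' \<Longrightarrow> reach prog T' c c'"
  unfolding reach_def using le_trans by blast

lemma reach_trans:
  assumes "reach prog T c c'" "reach prog T' c' c''"
  shows "reach prog (T + T') c c''"
proof -
  obtain t t' where "t \<le> T" "(step prog ^^ t) c = c'" "t' \<le> T'" "(step prog ^^ t') c' = c''"
    using assms unfolding reach_def by blast
  then have "t' + t \<le> T + T'" "(step prog ^^ (t' + t)) c = c''"
    by (simp_all add: funpow_add)
  then show ?thesis unfolding reach_def by blast
qed

text \<open>Symbolic execution: as an introduction rule, it consumes the instruction at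
  \<open>p\<close> and leaves the run from the next configuration.\<close>

lemma reach_exec:
  assumes "p < length prog" "prog ! p = ins" "reach prog T (exec ins (p, R, M)) c'"
  shows "reach prog (Suc T) (p, R, M) c'"
proof -
  have "reach prog 1 (p, R, M) (exec ins (p, R, M))"
    unfolding reach_def using assms by (intro exI[of _ 1]) (simp add: step_def)
  then show ?thesis using reach_trans[OF _ assms(3), of 1] by simp
qed

definition code_at :: "instr list \<Rightarrow> nat \<Rightarrow> instr list \<Rightarrow> bool" where
  "code_at prog p cs \<longleftrightarrow> (\<forall>i<length cs. p + i < length prog \<and> prog ! (p + i) = cs ! i)"

lemma code_at_Nil [simp]: "code_at prog p []"
  by (simp add: code_at_def)

lemma code_at_Cons [simp]:
  "code_at prog p (c # cs) \<longleftrightarrow> p < length prog \<and> prog ! p = c \<and> code_at prog (Suc p) cs"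
  by (auto simp: code_at_def nth_Cons less_Suc_eq_0_disj split: nat.splits)

lemma code_at_append [simp]:
  "code_at prog p (cs @ ds) \<longleftrightarrow> code_at prog p cs \<and> code_at prog (p + length cs) ds"
proof (induction cs arbitrary: p)
  case (Cons c cs)
  then show ?case by simp
qed simp

lemma code_at_self: "code_at prog 0 prog"
  by (simp add: code_at_def)

text \<open>Register \<open>v\<close> counts up to the bound in register \<open>k\<close>. Truncated
  subtraction makes \<open>k + 1\<close> zero exactly when the bound is reached; later
  \<open>k + 1\<close> supplies the increment. Jump targets are absolute, so code depends on its
  position. In the exit address, 5 stands for the two instructions before the body and the three
  after it.\<close>

definition for_loop :: "nat \<Rightarrow> nat \<Rightarrow> (nat \<Rightarrow> instr list) \<Rightarrow> nat \<Rightarrow> instr list" where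
  "for_loop v k body p = (let cb = body (p + 2) in
     [Sub (k + 1) k v, Jump_zero (k + 1) (p + length cb + 5)] @ cb @
     [Const (k + 1) 1, Add v v (k + 1), Jump p])"

text \<open>\<open>T + 5\<close> is the body with the test and the tail of a round, the final 2 is
  the test that leaves the loop. \<open>Inv\<close> holds where a round starts; the updates in the
  premise on the body are those made by the tail, and \<open>k + 1 := 0\<close> is what the last
  test leaves.\<close>

lemma reach_for_loop:
  assumes code: "code_at prog p (for_loop v k body p)"
    and v: "v \<noteq> k" "v \<noteq> k + 1"
    and inv: "\<And>i R M. Inv i R M \<Longrightarrow> R v = i \<and> R k = b"
    and body: "\<And>i R M. i < b \<Longrightarrow> Inv i R M \<Longrightarrow>
      \<exists>R' M'. reach prog T (p + 2, R(k + 1 := b - i), M) (p + 2 + length (body (p + 2)), R', M') \<and>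
        R' v = i \<and> Inv (Suc i) (R'(k + 1 := 1, v := Suc i)) M'"
    and init: "Inv 0 R M"
  shows "\<exists>R' M'. reach prog ((T + 5) * b + 2) (p, R, M)
           (p + length (for_loop v k body p), R'(k + 1 := 0), M') \<and> Inv b R' M'"
proof -
  let ?l = "length (body (p + 2))"
  have len: "length (for_loop v k body p) = ?l + 5"
    by (simp add: for_loop_def Let_def)
  have c: "p < length prog" "prog ! p = Sub (k + 1) k v" "Suc p < length prog"
    "prog ! Suc p = Jump_zero (k + 1) (p + ?l + 5)"
    "p + 2 + ?l < length prog" "prog ! (p + 2 + ?l) = Const (k + 1) 1"
    "Suc (p + 2 + ?l) < length prog" "prog ! Suc (p + 2 + ?l) = Add v v (k + 1)"
    "Suc (Suc (p + 2 + ?l)) < length prog" "prog ! Suc (Suc (p + 2 + ?l)) = Jump p"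
    using code by (auto simp: for_loop_def Let_def eval_nat_numeral)
  have *: "\<exists>R' M'. reach prog ((T + 5) * i) (p, R, M) (p, R', M') \<and> Inv i R' M'" if "i \<le> b" for i
    using that
  proof (induction i)
    case 0
    show ?case using init reach_refl by blast
  next
    case (Suc i)
    then obtain R1 M1 where 1: "reach prog ((T + 5) * i) (p, R, M) (p, R1, M1)" "Inv i R1 M1"
      by auto
    obtain R2 M2 where 2: "reach prog T (p + 2, R1(k + 1 := b - i), M1) (p + 2 + ?l, R2, M2)"
      "R2 v = i" "Inv (Suc i) (R2(k + 1 := 1, v := Suc i)) M2"
      using body[OF _ 1(2)] Suc.prems by auto
    have "reach prog (Suc (Suc T)) (p, R1, M1) (p + 2 + ?l, R2, M2)"
      apply (rule reach_exec[OF c(1,2)])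
      using inv[OF 1(2)] Suc.prems 2(1)
      by (auto intro!: reach_exec[OF c(3,4)])
    moreover have "reach prog (Suc (Suc (Suc 0))) (p + 2 + ?l, R2, M2) (p, R2(k + 1 := 1, v := Suc i), M2)"
      apply (rule reach_exec[OF c(5,6)], unfold exec.simps)
      apply (rule reach_exec[OF c(7,8)], unfold exec.simps)
      apply (rule reach_exec[OF c(9,10)], unfold exec.simps)
      using 2(2) v by (simp add: reach_refl)
    ultimately have "reach prog (Suc (Suc T) + 3) (p, R1, M1) (p, R2(k + 1 := 1, v := Suc i), M2)"
      using reach_trans by (metis numeral_3_eq_3)
    then have "reach prog ((T + 5) * i + (Suc (Suc T) + 3)) (p, R, M) (p, R2(k + 1 := 1, v := Suc i), M2)"
      using reach_trans 1(1) by blast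
    moreover have "(T + 5) * i + (Suc (Suc T) + 3) = (T + 5) * Suc i" by simp
    ultimately show ?case using 2(3) by metis
  qed
  obtain R1 M1 where 1: "reach prog ((T + 5) * b) (p, R, M) (p, R1, M1)" "Inv b R1 M1"
    using *[of b] by auto
  have "reach prog (Suc (Suc 0)) (p, R1, M1) (p + ?l + 5, R1(k + 1 := 0), M1)"
    apply (rule reach_exec[OF c(1,2)])
    using inv[OF 1(2)]
    by (auto intro!: reach_exec[OF c(3,4)] reach_refl)
  then have "reach prog ((T + 5) * b + 2) (p, R, M) (p + ?l + 5, R1(k + 1 := 0), M1)"
    using reach_trans 1(1) by (metis numeral_2_eq_2)
  then show ?thesis using 1(2) unfolding len by (metis add.assoc)
qed

section \<open>A language of polynomial-time expressions and its compiler\<close>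

section \<open>Expressions with bounded sums\<close>

text \<open>Expressions read the memory but never write it. Products and quantifiers are sums, and
  comparisons come from truncated subtraction.\<close>

datatype exp =
    Var nat
  | Num nat
  | Plus exp exp
  | Minus exp exp
  | Ld exp
  | Sum nat exp exp

fun eval :: "exp \<Rightarrow> (nat \<Rightarrow> nat) \<Rightarrow> (nat \<Rightarrow> nat) \<Rightarrow> nat" where
  "eval (Var v) s M = s v"
| "eval (Num c) s M = c"
| "eval (Plus a b) s M = eval a s M + eval b s M"
| "eval (Minus a b) s M = eval a s M - eval b s M"
| "eval (Ld a) s M = M (eval a s M)"
| "eval (Sum v b e) s M = (\<Sum>x<eval b s M. eval e (s(v := x)) M)"

fun vars :: "exp \<Rightarrow> nat set" where
  "vars (Var v) = {v}"
| "vars (Num c) = {}"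
| "vars (Plus a b) = vars a \<union> vars b"
| "vars (Minus a b) = vars a \<union> vars b"
| "vars (Ld a) = vars a"
| "vars (Sum v b e) = insert v (vars b \<union> vars e)"

lemma finite_vars: "finite (vars e)"
  by (induction e) auto

lemma eval_cong: "(\<And>v. v \<in> vars e \<Longrightarrow> s v = s' v) \<Longrightarrow> eval e s M = eval e s' M"
proof (induction e arbitrary: s s')
  case (Plus a b)
  have "eval a s M = eval a s' M" "eval b s M = eval b s' M"
    using Plus.prems by (auto intro: Plus.IH)
  then show ?case by simp
next
  case (Minus a b)
  have "eval a s M = eval a s' M" "eval b s M = eval b s' M"
    using Minus.prems by (auto intro: Minus.IH)
  then show ?case by simp
next
  case (Ld a)
  have "eval a s M = eval a s' M"
    using Ld.prems by (auto intro: Ld.IH)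
  then show ?case by simp
next
  case (Sum v b e)
  have "eval b s M = eval b s' M" using Sum.prems by (intro Sum.IH) auto
  moreover have "eval e (s(v := x)) M = eval e (s'(v := x)) M" for x
    using Sum.prems by (intro Sum.IH) auto
  ultimately show ?case by simp
qed simp_all

text \<open>The value ends up in register \<open>k\<close>; registers from \<open>k\<close> on are scratch, those below
  \<open>k\<close> hold the variables and are restored. The code is placed at position \<open>p\<close>.\<close>

fun comp :: "exp \<Rightarrow> nat \<Rightarrow> nat \<Rightarrow> instr list" where
  "comp (Var v) k p = [Const k 0, Add k k v]"
| "comp (Num c) k p = [Const k c]"
| "comp (Plus a b) k p = (let ca = comp a k p in
     ca @ comp b (k + 1) (p + length ca) @ [Add k k (k + 1)])"
| "comp (Minus a b) k p = (let ca = comp a k p in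
     ca @ comp b (k + 1) (p + length ca) @ [Sub k k (k + 1)])"
| "comp (Ld a) k p = comp a k p @ [Load k k]"
| "comp (Sum v b e) k p = (let cb = comp b (k + 1) p in
     cb @ [Const (k + 3) 0, Add (k + 3) (k + 3) v, Const k 0, Const v 0] @
     for_loop v (k + 1) (\<lambda>p. comp e (k + 4) p @ [Add k k (k + 4)]) (p + length cb + 4) @
     [Const v 0, Add v v (k + 3)])"

text \<open>One polynomial bounds time and value, since a value can become the number of rounds of a
  loop. It depends on the expression only and is evaluated at any \<open>K\<close> that dominates
  the variables and the cells. Taking a larger \<open>K\<close> where variables may grow avoids an
  appeal to monotonicity of polynomials.\<close>

definition computes :: "exp \<Rightarrow> nat poly \<Rightarrow> bool" where
  "computes e q \<longleftrightarrow> (\<forall>prog p k R M K.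
     code_at prog p (comp e k p) \<longrightarrow> vars e \<subseteq> {..<k} \<longrightarrow> (\<forall>v\<in>vars e. R v \<le> K) \<longrightarrow> (\<forall>a. M a \<le> K) \<longrightarrow>
     eval e R M \<le> poly q K \<and>
     (\<exists>R'. reach prog (poly q K) (p, R, M) (p + length (comp e k p), R', M) \<and>
        R' k = eval e R M \<and> (\<forall>r<k. R' r = R r)))"

lemma computesD:
  assumes "computes e q" "code_at prog p (comp e k p)" "vars e \<subseteq> {..<k}"
    "\<forall>v\<in>vars e. R v \<le> K" "\<forall>a. M a \<le> K"
  shows "eval e R M \<le> poly q K"
    "\<exists>R'. reach prog (poly q K) (p, R, M) (p + length (comp e k p), R', M) \<and>
        R' k = eval e R M \<and> (\<forall>r<k. R' r = R r)"
  using assms unfolding computes_def by blast+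

text \<open>Addition and truncated subtraction are treated alike: the bounds only require a result
  of at most the sum of the operands.\<close>

lemma computes_binary:
  assumes a: "computes a qa" and b: "computes b qb"
    and comp: "\<And>k p. comp e k p = comp a k p @ comp b (k + 1) (p + length (comp a k p)) @ [op k k (k + 1)]"
    and vars: "vars e = vars a \<union> vars b"
    and eval: "\<And>s M. eval e s M = f (eval a s M) (eval b s M)"
    and op: "\<And>r s t p R M. exec (op r s t) (p, R, M) = (Suc p, R(r := f (R s) (R t)), M)"
    and f: "\<And>x y. f x y \<le> x + y"
  shows "computes e (qa + qb + [:1:])"
  unfolding computes_def
proof (intro allI impI)
  fix prog p k R and M :: "nat \<Rightarrow> nat" and K
  assume code: "code_at prog p (comp e k p)" and vs: "vars e \<subseteq> {..<k}"
    and K: "\<forall>v\<in>vars e. R v \<le> K" "\<forall>a. M a \<le> (K::nat)"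
  let ?p1 = "p + length (comp a k p)"
  let ?p2 = "?p1 + length (comp b (k + 1) ?p1)"
  have codes: "code_at prog p (comp a k p)" "code_at prog ?p1 (comp b (k + 1) ?p1)"
    "?p2 < length prog" "prog ! ?p2 = op k k (k + 1)"
    using code unfolding comp by (simp_all add: add.assoc)
  obtain R1 where 1: "eval a R M \<le> poly qa K" "reach prog (poly qa K) (p, R, M) (?p1, R1, M)"
    "R1 k = eval a R M" "\<forall>r<k. R1 r = R r"
    using computesD[OF a codes(1), of R K M] vs K vars by auto
  have eb: "eval b R1 M = eval b R M"
    using 1(4) vs vars by (intro eval_cong) auto
  obtain R2 where 2: "eval b R1 M \<le> poly qb K" "reach prog (poly qb K) (?p1, R1, M) (?p2, R2, M)"
    "R2 (k + 1) = eval b R1 M" "\<forall>r<k + 1. R2 r = R1 r"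
  proof -
    have "vars b \<subseteq> {..<k + 1}" "\<forall>v\<in>vars b. R1 v \<le> K" "\<forall>a. M a \<le> K"
      using vs K vars 1(4) by auto
    from computesD[OF b codes(2) this] that show thesis by blast
  qed
  have "reach prog (Suc 0) (?p2, R2, M) (Suc ?p2, R2(k := f (R2 k) (R2 (k + 1))), M)"
    by (rule reach_exec[OF codes(3,4)]) (simp add: op reach_refl)
  then have r: "reach prog (poly qa K + (poly qb K + Suc 0)) (p, R, M)
      (Suc ?p2, R2(k := f (R2 k) (R2 (k + 1))), M)"
    using 1(2) 2(2) reach_trans by blast
  have "f (eval a R M) (eval b R M) \<le> poly qa K + poly qb K"
    using f 1(1) 2(1) eb by (metis add_mono order_trans)
  moreover have len: "p + length (comp e k p) = Suc ?p2" by (simp add: comp)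
  ultimately show "eval e R M \<le> poly (qa + qb + [:1:]) K \<and>
     (\<exists>R'. reach prog (poly (qa + qb + [:1:]) K) (p, R, M) (p + length (comp e k p), R', M) \<and>
        R' k = eval e R M \<and> (\<forall>r<k. R' r = R r))"
    unfolding len eval using r 1(3,4) 2(3,4) eb
    by (intro conjI exI[of _ "R2(k := f (R2 k) (R2 (k + 1)))"]) simp_all
qed

text \<open>Registers: \<open>k\<close> the partial sum, \<open>k + 1\<close> the bound,
  \<open>k + 2\<close> scratch of the loop, \<open>k + 3\<close> the saved value of
  \<open>v\<close>, and from \<open>k + 4\<close> on the body. Inside the loop \<open>v\<close> can
  grow up to the bound, so the body is bounded at \<open>K + poly qb K\<close>; hence the
  composition of polynomials. The constants 20 are generous room for the fixed instructions.\<close>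

lemma computes_Sum:
  assumes b: "computes b qb" and e: "computes e qe"
  shows "computes (Sum v b e) ((qb + [:20:]) * (pcompose qe ([:0, 1:] + qb) + [:20:]))"
  unfolding computes_def
proof (intro allI impI)
  fix prog p k R and M :: "nat \<Rightarrow> nat" and K
  let ?c = "Sum v b e"
  assume code: "code_at prog p (comp ?c k p)" and vs: "vars ?c \<subseteq> {..<k}"
    and K: "\<forall>v\<in>vars ?c. R v \<le> K" "\<forall>a. M a \<le> (K::nat)"
  define p1 where "p1 = p + length (comp b (k + 1) p)"
  define body where "body = (\<lambda>p. comp e (k + 4) p @ [Add k k (k + 4)])"
  define p2 where "p2 = p1 + 4 + length (for_loop v (k + 1) body (p1 + 4))"
  have c: "comp ?c k p = comp b (k + 1) p @
      [Const (k + 3) 0, Add (k + 3) (k + 3) v, Const k 0, Const v 0] @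
      for_loop v (k + 1) body (p1 + 4) @ [Const v 0, Add v v (k + 3)]"
    by (simp only: comp.simps Let_def p1_def body_def)
  have len: "p + length (comp ?c k p) = p2 + 2"
    unfolding c p2_def p1_def by (simp only: length_append list.size)
  have codes: "code_at prog p (comp b (k + 1) p)"
    "p1 < length prog" "prog ! p1 = Const (k + 3) 0"
    "Suc p1 < length prog" "prog ! Suc p1 = Add (k + 3) (k + 3) v"
    "Suc (Suc p1) < length prog" "prog ! Suc (Suc p1) = Const k 0"
    "Suc (Suc (Suc p1)) < length prog" "prog ! Suc (Suc (Suc p1)) = Const v 0"
    "code_at prog (p1 + 4) (for_loop v (k + 1) body (p1 + 4))"
    "p2 < length prog" "prog ! p2 = Const v 0"
    "Suc p2 < length prog" "prog ! Suc p2 = Add v v (k + 3)"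
  proof -
    have "code_at prog p (comp b (k + 1) p) \<and>
        code_at prog p1 [Const (k + 3) 0, Add (k + 3) (k + 3) v, Const k 0, Const v 0] \<and>
        code_at prog (p1 + 4) (for_loop v (k + 1) body (p1 + 4)) \<and>
        code_at prog p2 [Const v 0, Add v v (k + 3)]"
      using code[unfolded c code_at_append, folded p1_def] unfolding p2_def
      by (simp add: eval_nat_numeral del: code_at_Cons)
    then show "code_at prog p (comp b (k + 1) p)"
      "p1 < length prog" "prog ! p1 = Const (k + 3) 0"
      "Suc p1 < length prog" "prog ! Suc p1 = Add (k + 3) (k + 3) v"
      "Suc (Suc p1) < length prog" "prog ! Suc (Suc p1) = Const k 0"
      "Suc (Suc (Suc p1)) < length prog" "prog ! Suc (Suc (Suc p1)) = Const v 0"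
      "code_at prog (p1 + 4) (for_loop v (k + 1) body (p1 + 4))"
      "p2 < length prog" "prog ! p2 = Const v 0"
      "Suc p2 < length prog" "prog ! Suc p2 = Add v v (k + 3)"
      by simp_all
  qed
  have vk: "v < k" using vs by simp
  define B where "B = eval b R M"
  obtain R1 where 1: "B \<le> poly qb K" "reach prog (poly qb K) (p, R, M) (p1, R1, M)"
    "R1 (k + 1) = B" "\<forall>r<k + 1. R1 r = R r"
  proof -
    have "vars b \<subseteq> {..<k + 1}" "\<forall>v\<in>vars b. R v \<le> K" "\<forall>a. M a \<le> K"
      using vs K by auto
    from computesD[OF b codes(1) this] that show thesis unfolding p1_def B_def by blast
  qed
  define R2 where "R2 = R1(k + 3 := R v, k := 0, v := 0)"
  have 2: "reach prog (Suc (Suc (Suc (Suc 0)))) (p1, R1, M) (p1 + 4, R2, M)"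
    apply (rule reach_exec[OF codes(2,3)], unfold exec.simps)
    apply (rule reach_exec[OF codes(4,5)], unfold exec.simps)
    apply (rule reach_exec[OF codes(6,7)], unfold exec.simps)
    apply (rule reach_exec[OF codes(8,9)], unfold exec.simps)
    using 1(4) vk by (simp add: R2_def reach_refl eval_nat_numeral)
  define K' where "K' = K + poly qb K"
  define Inv where "Inv = (\<lambda>i R' M'. M' = M \<and> R' v = i \<and> R' (k + 1) = B \<and>
     R' k = (\<Sum>x<i. eval e (R(v := x)) M) \<and> R' (k + 3) = R v \<and> (\<forall>r<k. r \<noteq> v \<longrightarrow> R' r = R r))"
  have ebound: "eval e (R'(v := i)) M \<le> poly qe K' \<and>
     (code_at prog (p1 + 6) (comp e (k + 4) (p1 + 6)))" if "i < B"
     "\<forall>r<k. r \<noteq> v \<longrightarrow> R' r = R r" for i R'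
  proof -
    have c: "code_at prog (p1 + 6) (comp e (k + 4) (p1 + 6))"
      using codes(10) by (simp add: for_loop_def Let_def body_def add_ac eval_nat_numeral)
    have "eval e (R'(v := i)) M \<le> poly qe K'"
    proof (rule computesD(1)[OF e c])
      show "vars e \<subseteq> {..<k + 4}" using vs by auto
      show "\<forall>w\<in>vars e. (R'(v := i)) w \<le> K'"
      proof
        fix w assume w: "w \<in> vars e"
        then have "w < k" using vs by auto
        then show "(R'(v := i)) w \<le> K'"
          using w K that 1(1) by (cases "w = v") (auto simp: K'_def intro: trans_le_add1)
      qed
      show "\<forall>a. M a \<le> K'" using K by (auto simp: K'_def intro: trans_le_add1)
    qed
    then show ?thesis using c by blast
  qed
  have "\<exists>R' M'. reach prog ((poly qe K' + 1 + 5) * B + 2) (p1 + 4, R2, M)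
           (p1 + 4 + length (for_loop v (k + 1) body (p1 + 4)), R'(k + 1 + 1 := 0), M') \<and> Inv B R' M'"
  proof (rule reach_for_loop[OF codes(10)])
    show "v \<noteq> k + 1" "v \<noteq> k + 1 + 1" using vk by auto
    show "R v = i \<and> R (k + 1) = B" if "Inv i R M" for i R M
      using that by (simp add: Inv_def)
    show "Inv 0 R2 M" using 1(3,4) vk by (auto simp: Inv_def R2_def)
  next
    fix i R' M' assume i: "i < B" and I: "Inv i R' M'"
    have M': "M' = M" and I': "R' v = i" "R' (k + 1) = B" "R' k = (\<Sum>x<i. eval e (R(v := x)) M)"
      "R' (k + 3) = R v" "\<forall>r<k. r \<noteq> v \<longrightarrow> R' r = R r"
      using I by (auto simp: Inv_def)
    let ?R = "R'(k + 1 + 1 := B - i)"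
    have c: "code_at prog (p1 + 6) (comp e (k + 4) (p1 + 6))"
      using ebound[OF i I'(5)] by blast
    let ?p3 = "p1 + 6 + length (comp e (k + 4) (p1 + 6))"
    have c': "?p3 < length prog" "prog ! ?p3 = Add k k (k + 4)"
      using codes(10) by (simp_all add: for_loop_def Let_def body_def add_ac eval_nat_numeral)
    have "\<exists>R'. reach prog (poly qe K') (p1 + 6, ?R, M) (?p3, R', M) \<and> 
       R' (k + 4) = eval e ?R M \<and> (\<forall>r<k + 4. R' r = ?R r)"
    proof (rule computesD(2)[OF e c])
      show "vars e \<subseteq> {..<k + 4}" using vs by auto
      show "\<forall>w\<in>vars e. ?R w \<le> K'"
      proof
        fix w assume w: "w \<in> vars e"
        then have "w < k" using vs by auto
        then show "?R w \<le> K'"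
          using w K I' i 1(1) by (cases "w = v") (auto simp: K'_def intro: trans_le_add1)
      qed
      show "\<forall>a. M a \<le> K'" using K by (auto simp: K'_def intro: trans_le_add1)
    qed
    then obtain R3 where 3: "reach prog (poly qe K') (p1 + 6, ?R, M) (?p3, R3, M)"
      "R3 (k + 4) = eval e ?R M" "\<forall>r<k + 4. R3 r = ?R r" by blast
    have ee: "eval e ?R M = eval e (R(v := i)) M"
      using I' vs by (intro eval_cong) auto
    have r: "reach prog (Suc 0) (?p3, R3, M) (Suc ?p3, R3(k := R3 k + R3 (k + 4)), M)"
      by (rule reach_exec[OF c']) (simp add: reach_refl)
    have "reach prog (poly qe K' + Suc 0) (p1 + 6, ?R, M) (Suc ?p3, R3(k := R3 k + R3 (k + 4)), M)"
      using 3(1) r reach_trans by blast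
    moreover have "p1 + 4 + 2 + length (body (p1 + 4 + 2)) = Suc ?p3"
      by (simp add: body_def add_ac)
    moreover have "Inv (Suc i) ((R3(k := R3 k + R3 (k + 4)))(k + 1 + 1 := 1, v := Suc i)) M"
      using I' 3 vk ee by (auto simp: Inv_def)
    moreover have "(R3(k := R3 k + R3 (k + 4))) v = i" using vk 3(3) I' by simp
    ultimately show "\<exists>R'' M''. reach prog (poly qe K' + 1) (p1 + 4 + 2, ?R, M')
        (p1 + 4 + 2 + length (body (p1 + 4 + 2)), R'', M'') \<and>
        R'' v = i \<and> Inv (Suc i) (R''(k + 1 + 1 := 1, v := Suc i)) M''"
      unfolding M' by (intro exI[of _ "R3(k := R3 k + R3 (k + 4))"] exI[of _ M]) (simp add: add_ac)
  qed
  then obtain R3 M3 where R3: "reach prog ((poly qe K' + 1 + 5) * B + 2) (p1 + 4, R2, M)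
           (p2, R3(k + 1 + 1 := 0), M3)" "Inv B R3 M3"
    unfolding p2_def by blast
  then have "M3 = M" by (simp add: Inv_def)
  with R3 have 3: "reach prog ((poly qe K' + 6) * B + 2) (p1 + 4, R2, M)
           (p2, R3(k + 2 := 0), M)" "Inv B R3 M"
    by (simp_all add: add.commute)
  define R4 where "R4 = R3(k + 2 := 0, v := R v)"
  have 4: "reach prog (Suc (Suc 0)) (p2, R3(k + 2 := 0), M) (p2 + 2, R4, M)"
    apply (rule reach_exec[OF codes(11,12)], unfold exec.simps)
    apply (rule reach_exec[OF codes(13,14)], unfold exec.simps)
    using 3(2) vk by (simp add: R4_def reach_refl Inv_def)
  have "reach prog (poly qb K + (Suc (Suc (Suc (Suc 0))) + (((poly qe K' + 6) * B + 2) + Suc (Suc 0))))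
      (p, R, M) (p2 + 2, R4, M)"
    by (rule reach_trans[OF 1(2) reach_trans[OF 2 reach_trans[OF 3(1) 4]]])
  moreover have "poly qb K + (Suc (Suc (Suc (Suc 0))) + (((poly qe K' + 6) * B + 2) + Suc (Suc 0))) \<le> (poly qb K + 20) * (poly qe K' + 20)"
  proof -
    have "(poly qe K' + 6) * B \<le> (poly qe K' + 6) * poly qb K" using 1(1) by simp
    then show ?thesis by (simp add: algebra_simps)
  qed
  ultimately have r: "reach prog ((poly qb K + 20) * (poly qe K' + 20)) (p, R, M) (p2 + 2, R4, M)"
    using reach_mono by blast
  have res: "R4 k = eval ?c R M" "\<forall>r<k. R4 r = R r"
    using 3(2) vk by (auto simp: R4_def Inv_def B_def)
  have "eval ?c R M \<le> B * poly qe K'"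
    using sum_bounded_above[of "{..<B}" "\<lambda>x. eval e (R(v := x)) M" "poly qe K'"] ebound
    unfolding B_def by auto
  also have "\<dots> \<le> (poly qb K + 20) * (poly qe K' + 20)"
    using 1(1) by (intro mult_mono) auto
  finally show "eval ?c R M \<le> poly ((qb + [:20:]) * (pcompose qe ([:0, 1:] + qb) + [:20:])) K \<and>
     (\<exists>R'. reach prog (poly ((qb + [:20:]) * (pcompose qe ([:0, 1:] + qb) + [:20:])) K) (p, R, M)
        (p + length (comp ?c k p), R', M) \<and> R' k = eval ?c R M \<and> (\<forall>r<k. R' r = R r))"
    using r res unfolding len
    by (intro conjI exI[of _ R4]) (simp_all add: poly_pcompose K'_def del: eval.simps)
qed

lemma computes_exists: "\<exists>q. computes e q"
proof (induction e)
  case (Var v)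
  have "computes (Var v) [:2, 1:]"
    unfolding computes_def
  proof (intro allI impI)
    fix prog p k R and M :: "nat \<Rightarrow> nat" and K :: nat
    assume *: "code_at prog p (comp (Var v) k p)" "vars (Var v) \<subseteq> {..<k}" "\<forall>w\<in>vars (Var v). R w \<le> K"
    have "reach prog (Suc (Suc K)) (p, R, M) (p + length (comp (Var v) k p), R(k := R v), M)"
      apply (rule reach_exec[of _ _ "Const k 0"])
      using * apply (simp_all)
      apply (rule reach_exec[of _ _ "Add k k v"])
      using * by (simp_all add: reach_refl)
    then show "eval (Var v) R M \<le> poly [:2, 1:] K \<and>
      (\<exists>R'. reach prog (poly [:2, 1:] K) (p, R, M) (p + length (comp (Var v) k p), R', M) \<and>
        R' k = eval (Var v) R M \<and> (\<forall>r<k. R' r = R r))"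
      using * by (auto intro!: exI[of _ "R(k := R v)"])
  qed
  then show ?case by blast
next
  case (Num c)
  have "computes (Num c) [:Suc c:]"
    unfolding computes_def
  proof (intro allI impI)
    fix prog p k R and M :: "nat \<Rightarrow> nat" and K :: nat
    assume *: "code_at prog p (comp (Num c) k p)"
    have "reach prog (Suc c) (p, R, M) (p + length (comp (Num c) k p), R(k := c), M)"
      apply (rule reach_exec[of _ _ "Const k c"])
      using * by (simp_all add: reach_refl)
    then show "eval (Num c) R M \<le> poly [:Suc c:] K \<and>
      (\<exists>R'. reach prog (poly [:Suc c:] K) (p, R, M) (p + length (comp (Num c) k p), R', M) \<and>
        R' k = eval (Num c) R M \<and> (\<forall>r<k. R' r = R r))"
      by (auto intro!: exI[of _ "R(k := c)"])
  qed
  then show ?case by blast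
next
  case (Plus a b)
  then obtain qa qb where "computes a qa" "computes b qb" by blast
  then have "computes (Plus a b) (qa + qb + [:1:])"
    by (rule computes_binary[where f = "(+)" and op = Add]) (simp_all add: Let_def)
  then show ?case by blast
next
  case (Minus a b)
  then obtain qa qb where "computes a qa" "computes b qb" by blast
  then have "computes (Minus a b) (qa + qb + [:1:])"
    by (rule computes_binary[where f = "(-)" and op = Sub]) (simp_all add: Let_def)
  then show ?case by blast
next
  case (Ld a)
  then obtain q where a: "computes a q" by blast
  \<comment> \<open>The loaded value is a memory cell, hence at most \<open>K\<close>; the 1 pays
    for the instruction.\<close>
  have "computes (Ld a) (q + [:1, 1:])"
    unfolding computes_def
  proof (intro allI impI)
    fix prog p k R and M :: "nat \<Rightarrow> nat" and K :: nat
    assume *: "code_at prog p (comp (Ld a) k p)" "vars (Ld a) \<subseteq> {..<k}"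
      "\<forall>v\<in>vars (Ld a). R v \<le> K" "\<forall>a. M a \<le> K"
    let ?p1 = "p + length (comp a k p)"
    obtain R1 where 1: "reach prog (poly q K) (p, R, M) (?p1, R1, M)"
      "R1 k = eval a R M" "\<forall>r<k. R1 r = R r"
      using computesD(2)[OF a, of prog p k R K M] * by auto
    have "reach prog (Suc K) (?p1, R1, M) (Suc ?p1, R1(k := M (R1 k)), M)"
      apply (rule reach_exec[of _ _ "Load k k"])
      using * by (simp_all add: reach_refl)
    then have "reach prog (poly q K + Suc K) (p, R, M) (Suc ?p1, R1(k := M (R1 k)), M)"
      using 1(1) reach_trans by blast
    then show "eval (Ld a) R M \<le> poly (q + [:1, 1:]) K \<and>
      (\<exists>R'. reach prog (poly (q + [:1, 1:]) K) (p, R, M) (p + length (comp (Ld a) k p), R', M) \<and>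
        R' k = eval (Ld a) R M \<and> (\<forall>r<k. R' r = R r))"
      using 1 * by (auto intro!: exI[of _ "R1(k := M (R1 k))"] trans_le_add2 le_SucI)
  qed
  then show ?case by blast
next
  case (Sum v b e)
  then show ?case using computes_Sum by blast
qed

section \<open>From expressions for the output bits to a machine\<close>

text \<open>The output is first written behind the input of length \<open>R 0\<close>, so that every bit is computed
  from the unmodified input, and is then copied to the front.\<close>

definition write_program :: "exp \<Rightarrow> exp \<Rightarrow> nat \<Rightarrow> instr list" where
  "write_program L e k = (let cl = comp L k 0;
       l1 = for_loop 1 k (\<lambda>p. comp e (k + 2) p @ [Add (k + 3) 0 1, Store (k + 3) (k + 2)]) (length cl + 1)
     in cl @ [Const 1 0] @ l1 @ [Const 1 0] @
        for_loop 1 k (\<lambda>p. [Add (k + 3) 0 1, Load (k + 2) (k + 3), Store 1 (k + 2)])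
          (length cl + 1 + length l1 + 1) @
        [Const 0 0, Add 0 0 k])"

text \<open>\<open>L\<close> gives the length of the output and \<open>e\<close> its bit at position
  \<open>s 1\<close>. The assumption leaves the memory behind the input open, so \<open>e\<close>
  keeps its meaning while the output is being stored there.\<close>

theorem polynomial_time_by_expressions:
  fixes enc_in :: "'x \<Rightarrow> bool list" and enc_out :: "'y \<Rightarrow> bool list"
  assumes "\<And>x. x \<in> X \<Longrightarrow> \<exists>y. Sol x y \<and>
    (\<forall>s M. s 0 = length (enc_in x) \<longrightarrow> (\<forall>a<length (enc_in x). M a = of_bool (enc_in x ! a)) \<longrightarrow>
       eval L s M = length (enc_out y) \<and>
       (s 1 < length (enc_out y) \<longrightarrow> eval e s M = of_bool (enc_out y ! s 1)))"
  shows "solvable_in_polynomial_time X enc_in enc_out Sol"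
proof -
  obtain qL qe where qL: "computes L qL" and qe: "computes e qe"
    using computes_exists by blast
  have "finite (vars L \<union> vars e)" by (simp add: finite_vars)
  then obtain k0 where k0: "\<forall>v\<in>vars L \<union> vars e. v < k0"
    using finite_nat_set_iff_bounded by blast
  \<comment> \<open>The 2 keeps registers 0 and 1, the input length and the loop counter, below
    \<open>k\<close>.\<close>
  define k where "k = k0 + 2"
  have vk: "vars L \<subseteq> {..<k}" "vars e \<subseteq> {..<k + 2}" and k2: "2 \<le> k"
    using k0 by (auto simp: k_def intro!: less_SucI)
  define prog where "prog = write_program L e k"
  \<comment> \<open>The input length plus 1: the length bounds register 0, and the 1 bounds the
    input bits.\<close>
  define K1 where "K1 = ([:1, 1:] :: nat poly)"
  define q where "q = pcompose qL K1 + [:20:] + (pcompose qe (K1 + pcompose qL K1) + [:20:]) * pcompose qL K1"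
  show ?thesis
    unfolding solvable_in_polynomial_time_def
  proof (rule exI[of _ prog], rule exI[of _ q], rule ballI)
    fix x assume "x \<in> X"
    then obtain y where y: "Sol x y" and ev: "\<And>s M. s 0 = length (enc_in x) \<Longrightarrow>
        (\<forall>a<length (enc_in x). M a = of_bool (enc_in x ! a)) \<Longrightarrow>
        eval L s M = length (enc_out y) \<and>
        (s 1 < length (enc_out y) \<longrightarrow> eval e s M = of_bool (enc_out y ! s 1))"
      using assms by blast
    define N where "N = length (enc_in x)"
    define B where "B = length (enc_out y)"
    define M0 where "M0 = (\<lambda>a. if a < N then of_bool (enc_in x ! a) else (0::nat))"
    define R0 where "R0 = (\<lambda>r::nat. if r = 0 then N else (0::nat))"
    have init: "init_config (enc_in x) = (0, R0, M0)"
      unfolding init_config_def R0_def M0_def N_def by simp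
    define p1 where "p1 = length (comp L k 0)"
    define body1 where "body1 = (\<lambda>p. comp e (k + 2) p @ [Add (k + 3) 0 1, Store (k + 3) (k + 2)])"
    define body2 where "body2 = (\<lambda>p::nat. [Add (k + 3) 0 1, Load (k + 2) (k + 3), Store 1 (k + 2)])"
    define p2 where "p2 = p1 + 1 + length (for_loop 1 k body1 (p1 + 1))"
    define p3 where "p3 = p2 + 1 + length (for_loop 1 k body2 (p2 + 1))"
    have pr: "prog = comp L k 0 @ [Const 1 0] @ for_loop 1 k body1 (p1 + 1) @ [Const 1 0] @
        for_loop 1 k body2 (p2 + 1) @ [Const 0 0, Add 0 0 k]"
      by (simp only: prog_def write_program_def Let_def p1_def p2_def body1_def body2_def)
    have codes: "code_at prog 0 (comp L k 0)" "p1 < length prog" "prog ! p1 = Const 1 0"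
      "code_at prog (p1 + 1) (for_loop 1 k body1 (p1 + 1))"
      "p2 < length prog" "prog ! p2 = Const 1 0"
      "code_at prog (p2 + 1) (for_loop 1 k body2 (p2 + 1))"
      "p3 < length prog" "prog ! p3 = Const 0 0" "Suc p3 < length prog" "prog ! Suc p3 = Add 0 0 k"
      and lenp: "length prog = p3 + 2"
    proof -
      have "code_at prog 0 (comp L k 0) \<and> code_at prog p1 [Const 1 0] \<and>
          code_at prog (p1 + 1) (for_loop 1 k body1 (p1 + 1)) \<and>
          code_at prog p2 [Const 1 0] \<and> code_at prog (p2 + 1) (for_loop 1 k body2 (p2 + 1)) \<and>
          code_at prog p3 [Const 0 0, Add 0 0 k]"
        using code_at_self[of prog, unfolded arg_cong[OF pr, of "code_at prog 0"] code_at_append,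
          folded p1_def]
        unfolding p3_def p2_def by (simp del: code_at_Cons flip: p1_def)
      then show "code_at prog 0 (comp L k 0)" "p1 < length prog" "prog ! p1 = Const 1 0"
        "code_at prog (p1 + 1) (for_loop 1 k body1 (p1 + 1))"
        "p2 < length prog" "prog ! p2 = Const 1 0"
        "code_at prog (p2 + 1) (for_loop 1 k body2 (p2 + 1))"
        "p3 < length prog" "prog ! p3 = Const 0 0" "Suc p3 < length prog" "prog ! Suc p3 = Add 0 0 k"
        by simp_all
      show "length prog = p3 + 2"
        unfolding p3_def p2_def p1_def by (subst pr) (simp add: p1_def p2_def)
    qed
    have M01: "M0 a \<le> 1" for a by (simp add: M0_def)
    define K where "K = Suc N"
    have eL: "eval L R0 M0 = B"
      using ev[of R0 M0] unfolding R0_def M0_def N_def B_def by simp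
    have cond: "\<forall>v\<in>vars L. R0 v \<le> K" "\<forall>a. M0 a \<le> K"
      using M01 by (auto simp: R0_def K_def intro: le_SucI order_trans[OF M01])
    obtain R1 where 1: "B \<le> poly qL K" "reach prog (poly qL K) (0, R0, M0) (p1, R1, M0)"
      "R1 k = B" "\<forall>r<k. R1 r = R0 r"
      using computesD[OF qL codes(1) vk(1) cond] unfolding eL p1_def by auto
    define R2 where "R2 = R1(1 := 0)"
    have 2: "reach prog (Suc 0) (p1, R1, M0) (p1 + 1, R2, M0)"
      by (rule reach_exec[OF codes(2,3)]) (simp add: R2_def reach_refl)
    define K' where "K' = K + poly qL K"
    define Mid where "Mid = (\<lambda>i a. if N \<le> a \<and> a < N + i then of_bool (enc_out y ! (a - N)) else M0 a)"
    \<comment> \<open>The remaining registers below \<open>k\<close> stay 0, so that all variables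
      of \<open>e\<close> satisfy the bound \<open>K'\<close> required by
      \<open>computes\<close>.\<close>
    define Inv1 where "Inv1 = (\<lambda>i R M. M = Mid i \<and> R 1 = i \<and> R k = B \<and> R 0 = N \<and>
       (\<forall>r<k. r \<noteq> 0 \<longrightarrow> r \<noteq> 1 \<longrightarrow> R r = 0))"
    have "\<exists>R' M'. reach prog ((poly qe K' + 2 + 5) * B + 2) (p1 + 1, R2, M0)
             (p1 + 1 + length (for_loop 1 k body1 (p1 + 1)), R'(k + 1 := 0), M') \<and> Inv1 B R' M'"
    proof (rule reach_for_loop[OF codes(4)])
      show "1 \<noteq> k" "1 \<noteq> k + 1" using k2 by auto
      show "R 1 = i \<and> R k = B" if "Inv1 i R M" for i R M
        using that by (simp add: Inv1_def)
      show "Inv1 0 R2 M0" using 1(3,4) k2 by (auto simp: Inv1_def R2_def Mid_def R0_def fun_eq_iff)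
    next
      fix i R M assume i: "i < B" and I: "Inv1 i R M"
      let ?R = "R(k + 1 := B - i)"
      let ?p = "p1 + 1 + 2"
      let ?p' = "?p + length (comp e (k + 2) ?p)"
      have I': "M = Mid i" "R 1 = i" "R k = B" "R 0 = N" "\<forall>r<k. r \<noteq> 0 \<longrightarrow> r \<noteq> 1 \<longrightarrow> R r = 0"
        using I by (auto simp: Inv1_def)
      have c: "code_at prog ?p (comp e (k + 2) ?p)"
        "?p' < length prog" "prog ! ?p' = Add (k + 3) 0 1"
        "Suc ?p' < length prog" "prog ! Suc ?p' = Store (k + 3) (k + 2)"
        using codes(4) by (simp_all add: for_loop_def Let_def body1_def)
      have "\<exists>R'. reach prog (poly qe K') (?p, ?R, M) (?p', R', M) \<and>
        R' (k + 2) = eval e ?R M \<and> (\<forall>r<k + 2. R' r = ?R r)"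
      proof (rule computesD(2)[OF qe c(1) vk(2)])
        have "R w \<le> K'" if "w < k" for w
          using that I' i 1(1) by (cases "w = 0"; cases "w = 1") (auto simp: K'_def K_def)
        moreover have "w < k" if "w \<in> vars e" for w
          using k0 that by (auto simp: k_def intro!: less_SucI)
        ultimately show "\<forall>w\<in>vars e. ?R w \<le> K'" by fastforce
        have "M a \<le> 1" for a using M01 by (simp add: I' Mid_def)
        then show "\<forall>a. M a \<le> K'" by (auto simp: K'_def K_def intro: order_trans)
      qed
      then obtain R3 where 3: "reach prog (poly qe K') (?p, ?R, M) (?p', R3, M)"
        "R3 (k + 2) = eval e ?R M" "\<forall>r<k + 2. R3 r = ?R r" by blast
      have "eval e ?R M = of_bool (enc_out y ! i)"
        using ev[of ?R M] I' k2 i by (auto simp: Mid_def M0_def N_def B_def)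
      with 3(2) have v: "R3 (k + 2) = of_bool (enc_out y ! i)" by simp
      have R3: "R3 0 = N" "R3 1 = i" using 3(3) k2 I' by auto
      define R4 where "R4 = R3(k + 3 := N + i)"
      have M': "Mid (Suc i) = M(N + i := of_bool (enc_out y ! i))"
        by (auto simp: I' Mid_def fun_eq_iff)
      have "reach prog (Suc (Suc 0)) (?p', R3, M) (Suc (Suc ?p'), R4, Mid (Suc i))"
        apply (rule reach_exec[OF c(2,3)], unfold exec.simps)
        apply (rule reach_exec[OF c(4,5)], unfold exec.simps)
        using v by (simp add: R3 R4_def M' reach_refl del: One_nat_def)
      with 3(1) have "reach prog (poly qe K' + Suc (Suc 0)) (?p, ?R, M) (Suc (Suc ?p'), R4, Mid (Suc i))"
        using reach_trans by blast
      moreover have "?p + length (body1 ?p) = Suc (Suc ?p')" by (simp add: body1_def)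
      moreover have "R4 1 = i" using R3 k2 by (simp add: R4_def)
      moreover have "Inv1 (Suc i) (R4(k + 1 := 1, 1 := Suc i)) (Mid (Suc i))"
        using 3(3) I' k2 by (auto simp: Inv1_def R4_def)
      ultimately show "\<exists>R' M'. reach prog (poly qe K' + 2) (?p, ?R, M) (?p + length (body1 ?p), R', M') \<and>
          R' 1 = i \<and> Inv1 (Suc i) (R'(k + 1 := 1, 1 := Suc i)) M'"
        by (metis numeral_2_eq_2)
    qed
    then obtain R3 where 3: "reach prog ((poly qe K' + 2 + 5) * B + 2) (p1 + 1, R2, M0)
             (p2, R3(k + 1 := 0), Mid B)" "Inv1 B R3 (Mid B)"
      unfolding p2_def Inv1_def by blast
    define R4 where "R4 = R3(k + 1 := 0, 1 := 0)"
    have 4: "reach prog (Suc 0) (p2, R3(k + 1 := 0), Mid B) (p2 + 1, R4, Mid B)"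
      by (rule reach_exec[OF codes(5,6)]) (simp add: R4_def reach_refl)
    \<comment> \<open>If the output is longer than the input, copying overwrites parts of its
      source. Cell \<open>N + a\<close> is intact while \<open>i \<le> N + a\<close>, and this
      covers every cell still to be read.\<close>
    define Inv2 where "Inv2 = (\<lambda>i R (M :: nat \<Rightarrow> nat). R 1 = i \<and> R k = B \<and> R 0 = N \<and>
       (\<forall>a<i. M a = of_bool (enc_out y ! a)) \<and>
       (\<forall>a<B. i \<le> N + a \<longrightarrow> M (N + a) = of_bool (enc_out y ! a)))"
    have "\<exists>R' M'. reach prog ((3 + 5) * B + 2) (p2 + 1, R4, Mid B)
             (p2 + 1 + length (for_loop 1 k body2 (p2 + 1)), R'(k + 1 := 0), M') \<and> Inv2 B R' M'"
    proof (rule reach_for_loop[OF codes(7)])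
      show "1 \<noteq> k" "1 \<noteq> k + 1" using k2 by auto
      show "R 1 = i \<and> R k = B" if "Inv2 i R M" for i R M
        using that by (simp add: Inv2_def)
      show "Inv2 0 R4 (Mid B)" using 3(2) k2 by (auto simp: Inv1_def Inv2_def R4_def Mid_def)
    next
      fix i R M assume i: "i < B" and I: "Inv2 i R M"
      let ?R = "R(k + 1 := B - i)"
      let ?p = "p2 + 1 + 2"
      have I': "R 1 = i" "R k = B" "R 0 = N" using I by (auto simp: Inv2_def)
      have Mi: "M (N + i) = of_bool (enc_out y ! i)"
        using I i by (simp add: Inv2_def)
      have c: "?p < length prog" "prog ! ?p = Add (k + 3) 0 1"
        "Suc ?p < length prog" "prog ! Suc ?p = Load (k + 2) (k + 3)"
        "Suc (Suc ?p) < length prog" "prog ! Suc (Suc ?p) = Store 1 (k + 2)"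
        using codes(7) by (simp_all add: for_loop_def Let_def body2_def)
      define R' where "R' = ?R(k + 3 := N + i, k + 2 := of_bool (enc_out y ! i))"
      define M' where "M' = M(i := of_bool (enc_out y ! i))"
      have "reach prog (Suc (Suc (Suc 0))) (?p, ?R, M) (Suc (Suc (Suc ?p)), R', M')"
        apply (rule reach_exec[OF c(1,2)], unfold exec.simps)
        apply (rule reach_exec[OF c(3,4)], unfold exec.simps)
        apply (rule reach_exec[OF c(5,6)], unfold exec.simps)
        using k2 I' Mi by (simp add: R'_def M'_def reach_refl del: One_nat_def)
      moreover have "?p + length (body2 ?p) = Suc (Suc (Suc ?p))" by (simp add: body2_def)
      moreover have "R' 1 = i" using I' k2 by (simp add: R'_def)
      moreover have "Inv2 (Suc i) (R'(k + 1 := 1, 1 := Suc i)) M'"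
        using I k2 by (auto simp: Inv2_def R'_def M'_def less_Suc_eq)
      ultimately show "\<exists>R' M'. reach prog 3 (?p, ?R, M) (?p + length (body2 ?p), R', M') \<and>
          R' 1 = i \<and> Inv2 (Suc i) (R'(k + 1 := 1, 1 := Suc i)) M'"
        by (metis numeral_3_eq_3)
    qed
    then obtain R5 M5 where 5: "reach prog ((3 + 5) * B + 2) (p2 + 1, R4, Mid B) (p3, R5(k + 1 := 0), M5)"
      "Inv2 B R5 M5"
      unfolding p3_def by blast
    define R6 where "R6 = R5(k + 1 := 0, 0 := B)"
    have 6: "reach prog (Suc (Suc 0)) (p3, R5(k + 1 := 0), M5) (p3 + 2, R6, M5)"
      apply (rule reach_exec[OF codes(8,9)], unfold exec.simps)
      apply (rule reach_exec[OF codes(10,11)], unfold exec.simps)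
      using 5(2) k2 by (simp add: Inv2_def R6_def reach_refl)
    let ?T = "poly qL K + (Suc 0 + (((poly qe K' + 2 + 5) * B + 2) + (Suc 0 + (((3 + 5) * B + 2) + Suc (Suc 0)))))"
    have "reach prog ?T (0, R0, M0) (p3 + 2, R6, M5)"
      by (rule reach_trans[OF 1(2) reach_trans[OF 2 reach_trans[OF 3(1) reach_trans[OF 4 reach_trans[OF 5(1) 6]]]]])
    moreover have "?T \<le> poly q N"
    proof -
      have "poly q N = poly qL K + 20 + (poly qe K' + 20) * poly qL K"
        by (simp add: q_def K1_def poly_pcompose K'_def K_def)
      moreover have "(poly qe K' + 15) * B \<le> (poly qe K' + 20) * poly qL K"
        using 1(1) by (intro mult_le_mono) auto
      moreover have "(poly qe K' + 2 + 5) * B + (3 + 5) * B = (poly qe K' + 15) * B"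
        by (simp add: algebra_simps)
      ultimately show ?thesis by linarith
    qed
    ultimately obtain t where t: "t \<le> poly q N" "(step prog ^^ t) (0, R0, M0) = (p3 + 2, R6, M5)"
      unfolding reach_def by (meson order_trans)
    have "M5 i = of_bool (enc_out y ! i)" if "i < B" for i
      using 5(2) that unfolding Inv2_def by blast
    then have "halted_with prog (p3 + 2, R6, M5) (enc_out y)"
      by (simp add: lenp R6_def B_def)
    then show "\<exists>t y. t \<le> poly q (length (enc_in x)) \<and>
        halted_with prog ((step prog ^^ t) (init_config (enc_in x))) (enc_out y) \<and> Sol x y"
      using t y unfolding init N_def by metis
  qed
qed

section \<open>Row-major indices of the encoded matrices\<close>

section \<open>Positions in the encoding\<close>

lemma length_concat_equal:
  "(\<And>i. i < m \<Longrightarrow> length (g i) = l) \<Longrightarrow> length (concat (map g [0..<m])) = m * l"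
  by (induction m) auto

lemma nth_concat_equal:
  assumes "\<And>i. i < m \<Longrightarrow> length (g i) = l" "i < m" "j < l"
  shows "concat (map g [0..<m]) ! (i * l + j) = g i ! j"
  using assms
proof (induction m)
  case (Suc m)
  have len: "length (concat (map g [0..<m])) = m * l"
    using Suc.prems by (intro length_concat_equal) simp
  show ?case
  proof (cases "i = m")
    case True
    then show ?thesis using Suc.prems by (simp add: nth_append len)
  next
    case False
    then have "i < m" using Suc.prems by simp
    then have "Suc i * l \<le> m * l" by (intro mult_le_mono) auto
    then have "i * l + j < m * l" using Suc.prems by simp
    then show ?thesis using Suc.IH Suc.prems \<open>i < m\<close> by (simp add: nth_append len)
  qed
qed simp

lemma enc_matrix_map: "enc_matrix (map F [0..<n]) (map G [0..<n]) R =
    concat (map (\<lambda>i. map (\<lambda>j. (F i, G j) \<in> R) [0..<n]) [0..<n])"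
  by (simp add: enc_matrix_def comp_def)

lemma length_enc_matrix: "length (enc_matrix (map F [0..<n]) (map G [0..<n]) R) = n * n"
  unfolding enc_matrix_map by (rule length_concat_equal) simp

lemma nth_enc_matrix:
  assumes "i < n" "j < n"
  shows "enc_matrix (map F [0..<n]) (map G [0..<n]) R ! (i * n + j) \<longleftrightarrow> (F i, G j) \<in> R"
  unfolding enc_matrix_map using assms by (subst nth_concat_equal[where l = n]) auto

lemma index_less:
  assumes "i < m" "j < l" shows "i * l + j < m * (l :: nat)"
proof -
  have "Suc i * l \<le> m * l" using assms by (intro mult_le_mono) auto
  then show ?thesis using assms by simp
qed

lemma length_enc_pairs: "length (enc_pairs n X) = n * n"
  by (simp add: enc_pairs_def length_enc_matrix)

lemma nth_enc_pairs:
  "i < n \<Longrightarrow> j < n \<Longrightarrow> enc_pairs n X ! (i * n + j) \<longleftrightarrow> (Man i, Woman j) \<in> X"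
  by (simp add: enc_pairs_def nth_enc_matrix)

lemma length_enc_profile: "length (enc_profile n p) = (n + n) * n * n"
proof -
  have "length (concat (map (\<lambda>i. enc_matrix (map Woman [0..<n]) (map Woman [0..<n]) (p (Man i))) [0..<n])) = n * (n * n)"
    by (rule length_concat_equal) (simp add: length_enc_matrix)
  moreover have "length (concat (map (\<lambda>i. enc_matrix (map Man [0..<n]) (map Man [0..<n]) (p (Woman i))) [0..<n])) = n * (n * n)"
    by (rule length_concat_equal) (simp add: length_enc_matrix)
  ultimately show ?thesis by (simp add: enc_profile_def algebra_simps)
qed

text \<open>Both halves form one array with the agents as first index, the men below
  \<open>n\<close> and the women from \<open>n\<close> on. The Horner form of the index needs
  products with \<open>n\<close> only.\<close>

lemma nth_enc_profile:
  assumes "i < n" "c < n" "d < n"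
  shows "enc_profile n p ! ((i * n + c) * n + d) \<longleftrightarrow> (Woman c, Woman d) \<in> p (Man i)"
    "enc_profile n p ! (((n + i) * n + c) * n + d) \<longleftrightarrow> (Man c, Man d) \<in> p (Woman i)"
proof -
  let ?m = "concat (map (\<lambda>i. enc_matrix (map Woman [0..<n]) (map Woman [0..<n]) (p (Man i))) [0..<n])"
  let ?w = "concat (map (\<lambda>i. enc_matrix (map Man [0..<n]) (map Man [0..<n]) (p (Woman i))) [0..<n])"
  have len: "length ?m = n * (n * n)"
    by (rule length_concat_equal) (simp add: length_enc_matrix)
  have cd: "c * n + d < n * n" using assms by (intro index_less)
  have idx: "(i * n + c) * n + d = i * (n * n) + (c * n + d)"
    "((n + i) * n + c) * n + d = n * (n * n) + (i * (n * n) + (c * n + d))"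
    by (simp_all add: algebra_simps)
  have lt: "i * (n * n) + (c * n + d) < n * (n * n)"
    using assms cd by (intro index_less)
  have m: "?m ! (i * (n * n) + (c * n + d)) \<longleftrightarrow> (Woman c, Woman d) \<in> p (Man i)"
    using assms cd by (subst nth_concat_equal[where l = "n * n"]) (auto simp: length_enc_matrix nth_enc_matrix)
  have w: "?w ! (i * (n * n) + (c * n + d)) \<longleftrightarrow> (Man c, Man d) \<in> p (Woman i)"
    using assms cd by (subst nth_concat_equal[where l = "n * n"]) (auto simp: length_enc_matrix nth_enc_matrix)
  show "enc_profile n p ! ((i * n + c) * n + d) \<longleftrightarrow> (Woman c, Woman d) \<in> p (Man i)"
    unfolding idx enc_profile_def using m lt by (simp add: nth_append len)
  show "enc_profile n p ! (((n + i) * n + c) * n + d) \<longleftrightarrow> (Man c, Man d) \<in> p (Woman i)"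
    unfolding idx enc_profile_def using w by (simp add: nth_append len)
qed

lemma nth_middle: "p = length as \<Longrightarrow> k < length bs \<Longrightarrow> (as @ bs @ cs) ! (p + k) = bs ! k"
  by (simp add: nth_append)

lemma index3_less:
  assumes "c < n" "d < n" "x < n + n" shows "(x * n + c) * n + d < (n + n) * n * (n :: nat)"
  using assms by (intro index_less)

lemma enc_input_nth:
  fixes I P \<mu>
  defines "n \<equiv> num I" and "xs \<equiv> enc_input (I, P, \<mu>)"
  shows "length xs = n + 1 + n * n + (n + n) * n * n + (n + n) * n * n + n * n"
    "i < n \<Longrightarrow> xs ! i" "\<not> xs ! n"
    "i < n \<Longrightarrow> j < n \<Longrightarrow> xs ! (n + 1 + (i * n + j)) \<longleftrightarrow> (Man i, Woman j) \<in> acc I"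
    "i < n \<Longrightarrow> c < n \<Longrightarrow> d < n \<Longrightarrow>
       xs ! (n + 1 + n * n + ((i * n + c) * n + d)) \<longleftrightarrow> (Woman c, Woman d) \<in> pref I (Man i)"
    "i < n \<Longrightarrow> c < n \<Longrightarrow> d < n \<Longrightarrow>
       xs ! (n + 1 + n * n + (((n + i) * n + c) * n + d)) \<longleftrightarrow> (Man c, Man d) \<in> pref I (Woman i)"
    "i < n \<Longrightarrow> c < n \<Longrightarrow> d < n \<Longrightarrow>
       xs ! (n + 1 + n * n + (n + n) * n * n + ((i * n + c) * n + d)) \<longleftrightarrow> (Woman c, Woman d) \<in> P (Man i)"
    "i < n \<Longrightarrow> c < n \<Longrightarrow> d < n \<Longrightarrow>
       xs ! (n + 1 + n * n + (n + n) * n * n + (((n + i) * n + c) * n + d)) \<longleftrightarrow> (Man c, Man d) \<in> P (Woman i)"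
    "i < n \<Longrightarrow> j < n \<Longrightarrow>
       xs ! (n + 1 + n * n + (n + n) * n * n + (n + n) * n * n + (i * n + j)) \<longleftrightarrow> (Man i, Woman j) \<in> \<mu>"
proof -
  let ?u = "replicate n True @ [False]" let ?a = "enc_pairs n (acc I)"
  let ?p = "enc_profile n (pref I)" let ?q = "enc_profile n P" let ?m = "enc_pairs n \<mu>"
  have xs: "xs = ?u @ ?a @ ?p @ ?q @ ?m"
    by (simp add: xs_def n_def enc_instance_def)
  note len = length_enc_pairs length_enc_profile
  show "length xs = n + 1 + n * n + (n + n) * n * n + (n + n) * n * n + n * n"
    unfolding xs by (simp add: len)
  show "i < n \<Longrightarrow> xs ! i" "\<not> xs ! n" unfolding xs by (simp_all add: nth_append)
  show "xs ! (n + 1 + (i * n + j)) \<longleftrightarrow> (Man i, Woman j) \<in> acc I" if "i < n" "j < n"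
    unfolding xs using that by (subst nth_middle) (simp_all add: len index_less nth_enc_pairs)
  have p: "xs ! (n + 1 + n * n + k) = ?p ! k" if "k < (n + n) * n * n" for k
    unfolding xs using that nth_middle[of _ "?u @ ?a" k ?p "?q @ ?m"] by (simp add: len)
  have q: "xs ! (n + 1 + n * n + (n + n) * n * n + k) = ?q ! k" if "k < (n + n) * n * n" for k
    unfolding xs using that nth_middle[of _ "?u @ ?a @ ?p" k ?q ?m] by (simp add: len add.assoc)
  have m: "xs ! (n + 1 + n * n + (n + n) * n * n + (n + n) * n * n + k) = ?m ! k" if "k < n * n" for k
    unfolding xs using that nth_middle[of _ "?u @ ?a @ ?p @ ?q" k ?m "[]"] by (simp add: len add.assoc)
  show "xs ! (n + 1 + n * n + ((i * n + c) * n + d)) \<longleftrightarrow> (Woman c, Woman d) \<in> pref I (Man i)"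
    "xs ! (n + 1 + n * n + (n + n) * n * n + ((i * n + c) * n + d)) \<longleftrightarrow> (Woman c, Woman d) \<in> P (Man i)"
    if "i < n" "c < n" "d < n"
    using that index3_less[of c n d i] by (simp_all only: p q nth_enc_profile trans_less_add1)
  show "xs ! (n + 1 + n * n + (((n + i) * n + c) * n + d)) \<longleftrightarrow> (Man c, Man d) \<in> pref I (Woman i)"
    "xs ! (n + 1 + n * n + (n + n) * n * n + (((n + i) * n + c) * n + d)) \<longleftrightarrow> (Man c, Man d) \<in> P (Woman i)"
    if "i < n" "c < n" "d < n"
    using that index3_less[of c n d "n + i"] by (simp_all only: p q nth_enc_profile add_strict_left_mono)
  show "xs ! (n + 1 + n * n + (n + n) * n * n + (n + n) * n * n + (i * n + j)) \<longleftrightarrow> (Man i, Woman j) \<in> \<mu>"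
    if "i < n" "j < n"
    using m[OF index_less[OF that]] nth_enc_pairs[OF that] by simp
qed

lemma length_enc_instance:
  "length (enc_instance I) = num I + 1 + num I * num I + (num I + num I) * num I * num I"
  by (simp add: enc_instance_def length_enc_pairs length_enc_profile)

text \<open>Interviews change neither \<open>num\<close> nor \<open>acc\<close>, so this part of the
  output is copied from the input.\<close>

lemma enc_instance_nth_prefix:
  assumes "num J = num I" "acc J = acc I" "k < num I + 1 + num I * num I"
  shows "enc_instance J ! k = enc_input (I, P, \<mu>) ! k"
proof -
  let ?u = "replicate (num I) True @ [False] @ enc_pairs (num I) (acc I)"
  have "enc_instance J = ?u @ enc_profile (num I) (pref J)"
    "enc_input (I, P, \<mu>) = ?u @ enc_profile (num I) (pref I) @ enc_profile (num I) P @ enc_pairs (num I) \<mu>"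
    using assms by (simp_all add: enc_instance_def)
  moreover have "k < length ?u" using assms by (simp add: length_enc_pairs)
  ultimately show ?thesis by (metis nth_append)
qed

lemma enc_instance_nth_profile:
  assumes "k < (num I + num I) * num I * num I"
  shows "enc_instance I ! (num I + 1 + num I * num I + k) = enc_profile (num I) (pref I) ! k"
  using assms nth_middle[of _ "replicate (num I) True @ [False] @ enc_pairs (num I) (acc I)" k
    "enc_profile (num I) (pref I)" "[]"]
  by (simp add: enc_instance_def length_enc_pairs length_enc_profile)

text \<open>The indices are digits in base \<open>n\<close>, the leading one unbounded. Hence a
  search over all triples recognises the single cell that an output position denotes.\<close>

lemma index3_inject:
  fixes n :: nat
  assumes "c < n" "d < n" "c' < n" "d' < n" "(x * n + c) * n + d = (x' * n + c') * n + d'"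
  shows "x = x' \<and> c = c' \<and> d = d'"
proof -
  have *: "((x * n + c) * n + d) mod n = d \<and> ((x * n + c) * n + d) div n mod n = c \<and>
      ((x * n + c) * n + d) div n div n = x" if "c < n" "d < n" for x c d
    using that by simp
  show ?thesis using *[OF assms(1,2), of x] *[OF assms(3,4), of x'] assms(5) by metis
qed

lemma index3_exists:
  fixes n :: nat
  assumes "k < (n + n) * n * n"
  shows "\<exists>x c d. x < n + n \<and> c < n \<and> d < n \<and> k = (x * n + c) * n + d"
proof -
  have "n > 0" using assms by (cases n) auto
  moreover have "k div n div n < n + n" using assms by (simp add: less_mult_imp_div_less)
  ultimately show ?thesis
    by (intro exI[of _ "k div n div n"] exI[of _ "k div n mod n"] exI[of _ "k mod n"]) simp
qed

section \<open>Expressions for the optimal interviews and the output bits\<close>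

section \<open>The algorithm\<close>

text \<open>Zero is false, any other value is true. By truncated subtraction \<open>e_Not\<close>
  always yields 0 or 1, so a double \<open>e_Not\<close> normalises a sum to a truth value.\<close>

definition e_Not :: "exp \<Rightarrow> exp" where "e_Not e = Minus (Num 1) e"
definition e_Or :: "exp \<Rightarrow> exp \<Rightarrow> exp" where "e_Or a b = e_Not (e_Not (Plus a b))"
definition e_And :: "exp \<Rightarrow> exp \<Rightarrow> exp" where "e_And a b = e_Not (Plus (e_Not a) (e_Not b))"
definition e_Eq :: "exp \<Rightarrow> exp \<Rightarrow> exp" where "e_Eq a b = e_Not (Plus (Minus a b) (Minus b a))"
definition e_Ex :: "nat \<Rightarrow> exp \<Rightarrow> exp \<Rightarrow> exp" where "e_Ex v b e = e_Not (e_Not (Sum v b e))"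

lemma eval_Not [simp]: "eval (e_Not e) s M = of_bool (eval e s M = 0)"
  by (simp add: e_Not_def)

lemma eval_Or [simp]: "eval (e_Or a b) s M = of_bool (eval a s M \<noteq> 0 \<or> eval b s M \<noteq> 0)"
  by (simp add: e_Or_def)

lemma eval_And [simp]: "eval (e_And a b) s M = of_bool (eval a s M \<noteq> 0 \<and> eval b s M \<noteq> 0)"
  by (simp add: e_And_def)

lemma eval_Eq [simp]: "eval (e_Eq a b) s M = of_bool (eval a s M = eval b s M)"
  by (auto simp: e_Eq_def)

lemma eval_Ex [simp]:
  "eval (e_Ex v b e) s M = of_bool (\<exists>x\<in>{..<eval b s M}. eval e (s(v := x)) M \<noteq> 0)"
  by (auto simp: e_Ex_def)

text \<open>The number of agents on each side is read off the unary prefix. Bound variables: 20 and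
  21 here, 22 in products, 3 in \<open>e_unresolved\<close>, 5 to 7 in \<open>e_forced\<close>, 8 and 9 in
  \<open>e_interview\<close>, 10 to 12 in \<open>e_output\<close>, whose free variable 1 is the output position.\<close>

definition e_n :: exp where
  "e_n = Sum 20 (Var 0) (e_Not (Sum 21 (Plus (Var 20) (Num 1)) (e_Not (Ld (Var 21)))))"

definition e_times_n :: "exp \<Rightarrow> exp" where "e_times_n a = Sum 22 a e_n"

definition e_acc_pos :: exp where "e_acc_pos = Plus e_n (Num 1)"
definition e_pref_pos :: exp where "e_pref_pos = Plus e_acc_pos (e_times_n e_n)"
definition e_profile_pos :: exp where
  "e_profile_pos = Plus e_pref_pos (e_times_n (e_times_n (Plus e_n e_n)))"
definition e_matching_pos :: exp where
  "e_matching_pos = Plus e_profile_pos (e_times_n (e_times_n (Plus e_n e_n)))"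

definition e_cell2 :: "exp \<Rightarrow> nat \<Rightarrow> nat \<Rightarrow> exp" where
  "e_cell2 p i j = Ld (Plus p (Plus (e_times_n (Var i)) (Var j)))"
definition e_pos3 :: "exp \<Rightarrow> exp \<Rightarrow> nat \<Rightarrow> nat \<Rightarrow> exp" where
  "e_pos3 p x c d = Plus p (Plus (e_times_n (Plus (e_times_n x) (Var c))) (Var d))"

definition e_acc where "e_acc i j = e_cell2 e_acc_pos i j"
definition e_matched where "e_matched i j = e_cell2 e_matching_pos i j"
definition e_pref_man where "e_pref_man i c d = Ld (e_pos3 e_pref_pos (Var i) c d)"
definition e_pref_woman where "e_pref_woman j c d = Ld (e_pos3 e_pref_pos (Plus e_n (Var j)) c d)"
definition e_prof_man where "e_prof_man i c d = Ld (e_pos3 e_profile_pos (Var i) c d)"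
definition e_prof_woman where "e_prof_woman j c d = Ld (e_pos3 e_profile_pos (Plus e_n (Var j)) c d)"

definition e_unresolved where
  "e_unresolved i j = e_And (e_acc i j) (e_And (e_Not (e_matched i j)) (e_And
     (e_Not (e_Ex 3 e_n (e_And (e_matched i 3) (e_pref_man i 3 j))))
     (e_Not (e_Ex 3 e_n (e_And (e_matched 3 j) (e_pref_woman j 3 i))))))"

definition e_forced where
  "e_forced i = e_Or
     (e_Ex 5 e_n (e_And (e_unresolved i 5) (e_Not (e_Ex 6 e_n (e_And (e_matched 6 5) (e_prof_woman 5 6 i))))))
     (e_Ex 5 e_n (e_And (e_matched i 5) (e_Ex 6 e_n (e_And (e_unresolved 6 5)
        (e_Not (e_Ex 7 e_n (e_And (e_matched 6 7) (e_prof_man 6 7 5))))))))"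

definition e_interview where
  "e_interview i j = e_Or (e_unresolved i j) (e_And (e_matched i j) (e_Not (e_And (e_Not (e_forced i))
     (e_Not (e_Ex 8 (Var i) (e_Ex 9 e_n (e_And (e_matched 8 9) (e_And (e_Not (e_forced 8)) (e_unresolved i 9)))))))))"

text \<open>The output has the layout of the initial part of the input and keeps all its 1 bits,
  since interviews only add preferences. So a bit is the input bit at its position or marks a new
  comparison at the cell found by search.\<close>

definition e_output where
  "e_output = e_Or (Ld (Var 1)) (e_Or
     (e_Ex 10 e_n (e_Ex 11 e_n (e_Ex 12 e_n (e_And (e_Eq (Var 1) (e_pos3 e_pref_pos (Var 10) 11 12))
        (e_And (e_interview 10 11) (e_And (e_interview 10 12) (e_prof_man 10 11 12)))))))
     (e_Ex 10 e_n (e_Ex 11 e_n (e_Ex 12 e_n (e_And (e_Eq (Var 1) (e_pos3 e_pref_pos (Plus e_n (Var 10)) 11 12))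
        (e_And (e_interview 11 10) (e_And (e_interview 12 10) (e_prof_woman 10 11 12))))))))"

text \<open>What the expressions compute is kept apart from optimality. The memory is fixed on the
  input cells only, as in \<open>polynomial_time_by_expressions\<close>.\<close>

locale encoded =
  fixes I :: instance_data and P :: profile and \<mu> :: "(agent \<times> agent) set"
    and n :: nat and xs :: "bool list" and M :: "nat \<Rightarrow> nat"
  assumes n: "num I = n" and xs: "xs = enc_input (I, P, \<mu>)"
    and M: "\<And>k. k < length xs \<Longrightarrow> M k = of_bool (xs ! k)"
    and acc: "acc I \<subseteq> men I \<times> women I" and \<mu>: "\<mu> \<subseteq> men I \<times> women I"
begin

abbreviation N where "N \<equiv> length xs"

lemmas nth = enc_input_nth[where I = I and P = P and \<mu> = \<mu>, unfolded n xs[symmetric]]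

lemma N: "N = n + 1 + n * n + (n + n) * n * n + (n + n) * n * n + n * n"
  by (rule nth(1))

lemma M_cells:
  "i < n \<Longrightarrow> M i = 1" "M n = 0"
  "i < n \<Longrightarrow> j < n \<Longrightarrow> M (n + 1 + (i * n + j)) = of_bool ((Man i, Woman j) \<in> acc I)"
  "i < n \<Longrightarrow> c < n \<Longrightarrow> d < n \<Longrightarrow>
     M (n + 1 + n * n + ((i * n + c) * n + d)) = of_bool ((Woman c, Woman d) \<in> pref I (Man i))"
  "i < n \<Longrightarrow> c < n \<Longrightarrow> d < n \<Longrightarrow>
     M (n + 1 + n * n + (((n + i) * n + c) * n + d)) = of_bool ((Man c, Man d) \<in> pref I (Woman i))"
  "i < n \<Longrightarrow> c < n \<Longrightarrow> d < n \<Longrightarrow>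
     M (n + 1 + n * n + (n + n) * n * n + ((i * n + c) * n + d)) = of_bool ((Woman c, Woman d) \<in> P (Man i))"
  "i < n \<Longrightarrow> c < n \<Longrightarrow> d < n \<Longrightarrow>
     M (n + 1 + n * n + (n + n) * n * n + (((n + i) * n + c) * n + d)) = of_bool ((Man c, Man d) \<in> P (Woman i))"
  "i < n \<Longrightarrow> j < n \<Longrightarrow>
     M (n + 1 + n * n + (n + n) * n * n + (n + n) * n * n + (i * n + j)) = of_bool ((Man i, Woman j) \<in> \<mu>)"
proof -
  have M_eq: "k < N \<Longrightarrow> (xs ! k \<longleftrightarrow> Q) \<Longrightarrow> M k = of_bool Q" for k Q using M by simp
  show "i < n \<Longrightarrow> M i = 1" "M n = 0"
    using nth(2,3) M N by simp_all
  show "M (n + 1 + (i * n + j)) = of_bool ((Man i, Woman j) \<in> acc I)" if "i < n" "j < n"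
    using index_less[OF that] that by (intro M_eq nth(4)) (simp_all add: N)
  show "M (n + 1 + n * n + (n + n) * n * n + (n + n) * n * n + (i * n + j)) = of_bool ((Man i, Woman j) \<in> \<mu>)"
    if "i < n" "j < n"
    using index_less[OF that] that by (intro M_eq nth(9)) (simp_all add: N)
  show "M (n + 1 + n * n + ((i * n + c) * n + d)) = of_bool ((Woman c, Woman d) \<in> pref I (Man i))"
    if "i < n" "c < n" "d < n"
    using index3_less[of c n d i] that by (intro M_eq nth(5)) (simp_all add: N)
  show "M (n + 1 + n * n + (n + n) * n * n + ((i * n + c) * n + d)) = of_bool ((Woman c, Woman d) \<in> P (Man i))"
    if "i < n" "c < n" "d < n"
    using index3_less[of c n d i] that by (intro M_eq nth(7)) (simp_all add: N)
  show "M (n + 1 + n * n + (((n + i) * n + c) * n + d)) = of_bool ((Man c, Man d) \<in> pref I (Woman i))"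
    if "i < n" "c < n" "d < n"
    using index3_less[of c n d "n + i"] that by (intro M_eq nth(6)) (simp_all add: N)
  show "M (n + 1 + n * n + (n + n) * n * n + (((n + i) * n + c) * n + d)) = of_bool ((Man c, Man d) \<in> P (Woman i))"
    if "i < n" "c < n" "d < n"
    using index3_less[of c n d "n + i"] that by (intro M_eq nth(8)) (simp_all add: N)
qed

text \<open>A position contributes 1 iff no cell up to and including it is 0. The first zero is the
  separator at \<open>n\<close>, so exactly the positions below \<open>n\<close> are
  counted.\<close>

lemma e_n [simp]: assumes "s 0 = N" shows "eval e_n s M = n"
proof -
  have "eval e_n s M = (\<Sum>x<N. of_bool ((\<Sum>y<x + 1. of_bool (M y = 0)) = (0::nat)))"
    using assms unfolding e_n_def eval.simps eval_Not by simp
  also have "\<dots> = (\<Sum>x<N. of_bool (x < n))"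
  proof (intro sum.cong refl arg_cong[where f = of_bool])
    fix x
    have "(\<Sum>y<x + 1. of_bool (M y = 0)) = (0::nat) \<longleftrightarrow> (\<forall>y\<in>{..<x + 1}. of_bool (M y = 0) = (0::nat))"
      by (rule sum_eq_0_iff) simp
    also have "\<dots> \<longleftrightarrow> (\<forall>y<x + 1. M y \<noteq> 0)" by auto
    also have "\<dots> \<longleftrightarrow> x < n"
    proof
      assume *: "\<forall>y<x + 1. M y \<noteq> 0"
      show "x < n"
      proof (rule ccontr)
        assume "\<not> x < n"
        then show False using *[rule_format, of n] M_cells(2) by simp
      qed
    qed (simp add: M_cells(1))
    finally show "(\<Sum>y<x + 1. of_bool (M y = 0)) = (0::nat) \<longleftrightarrow> x < n" .
  qed
  also have "\<dots> = (\<Sum>x<n. 1)"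
    using N by (intro sum.mono_neutral_cong_right) auto
  also have "\<dots> = n" by simp
  finally show ?thesis .
qed

lemma e_times_n [simp]: "s 0 = N \<Longrightarrow> eval (e_times_n a) s M = eval a s M * n"
  by (simp add: e_times_n_def)

lemma e_positions [simp]:
  assumes "s 0 = N"
  shows "eval e_acc_pos s M = n + 1" "eval e_pref_pos s M = n + 1 + n * n"
    "eval e_profile_pos s M = n + 1 + n * n + (n + n) * n * n"
    "eval e_matching_pos s M = n + 1 + n * n + (n + n) * n * n + (n + n) * n * n"
    "eval (e_pos3 p x c d) s M = eval p s M + ((eval x s M * n + s c) * n + s d)"
    "eval (e_cell2 p i j) s M = M (eval p s M + (s i * n + s j))"
  using assms
  by (simp_all add: e_acc_pos_def e_pref_pos_def e_profile_pos_def e_matching_pos_def e_pos3_def e_cell2_def)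

lemma e_cells [simp]:
  assumes "s 0 = N"
  shows "s i < n \<Longrightarrow> s j < n \<Longrightarrow> eval (e_acc i j) s M = of_bool ((Man (s i), Woman (s j)) \<in> acc I)"
    "s i < n \<Longrightarrow> s j < n \<Longrightarrow> eval (e_matched i j) s M = of_bool ((Man (s i), Woman (s j)) \<in> \<mu>)"
    "s i < n \<Longrightarrow> s c < n \<Longrightarrow> s d < n \<Longrightarrow>
       eval (e_pref_man i c d) s M = of_bool ((Woman (s c), Woman (s d)) \<in> pref I (Man (s i)))"
    "s i < n \<Longrightarrow> s c < n \<Longrightarrow> s d < n \<Longrightarrow>
       eval (e_pref_woman i c d) s M = of_bool ((Man (s c), Man (s d)) \<in> pref I (Woman (s i)))"
    "s i < n \<Longrightarrow> s c < n \<Longrightarrow> s d < n \<Longrightarrow>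
       eval (e_prof_man i c d) s M = of_bool ((Woman (s c), Woman (s d)) \<in> P (Man (s i)))"
    "s i < n \<Longrightarrow> s c < n \<Longrightarrow> s d < n \<Longrightarrow>
       eval (e_prof_woman i c d) s M = of_bool ((Man (s c), Man (s d)) \<in> P (Woman (s i)))"
  using assms M_cells(3-)
  by (simp_all add: e_acc_def e_matched_def e_pref_man_def e_pref_woman_def e_prof_man_def e_prof_woman_def
      del: One_nat_def add_Suc_right)

text \<open>The definitions quantify over all agents; the matching and \<open>unresolved\<close>
  confine the witnesses to indices below \<open>n\<close>, which an expression can search.\<close>

lemma ex_bounded:
  "(\<exists>w. (Man i, w) \<in> \<mu> \<and> Q w) \<longleftrightarrow> (\<exists>x\<in>{..<n}. (Man i, Woman x) \<in> \<mu> \<and> Q (Woman x))"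
  "(\<exists>m. (m, Woman j) \<in> \<mu> \<and> Q m) \<longleftrightarrow> (\<exists>x\<in>{..<n}. (Man x, Woman j) \<in> \<mu> \<and> Q (Man x))"
  "(\<exists>w. unresolved I \<mu> m w \<and> Q w) \<longleftrightarrow> (\<exists>x\<in>{..<n}. unresolved I \<mu> m (Woman x) \<and> Q (Woman x))"
  "(\<exists>m. unresolved I \<mu> m w \<and> Q m) \<longleftrightarrow> (\<exists>x\<in>{..<n}. unresolved I \<mu> (Man x) w \<and> Q (Man x))"
proof -
  have \<mu>D: "(\<exists>x<n. m = Man x) \<and> (\<exists>x<n. w = Woman x)" if "(m, w) \<in> \<mu>" for m w
    using that \<mu> by (auto simp: men_def women_def n)
  have uD: "(\<exists>x<n. m = Man x) \<and> (\<exists>x<n. w = Woman x)" if "unresolved I \<mu> m w" for m w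
    using that acc by (auto simp: unresolved_def men_def women_def n)
  have bound: "(\<exists>a. p a \<and> Q a) \<longleftrightarrow> (\<exists>x\<in>{..<n}. p (F x) \<and> Q (F x))"
    if "\<And>a. p a \<Longrightarrow> \<exists>x<n. a = F x" for p Q and F :: "nat \<Rightarrow> agent"
    using that by blast
  show "(\<exists>w. (Man i, w) \<in> \<mu> \<and> Q w) \<longleftrightarrow> (\<exists>x\<in>{..<n}. (Man i, Woman x) \<in> \<mu> \<and> Q (Woman x))"
    by (rule bound) (rule conjunct2[OF \<mu>D])
  show "(\<exists>m. (m, Woman j) \<in> \<mu> \<and> Q m) \<longleftrightarrow> (\<exists>x\<in>{..<n}. (Man x, Woman j) \<in> \<mu> \<and> Q (Man x))"
    by (rule bound) (rule conjunct1[OF \<mu>D])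
  show "(\<exists>w. unresolved I \<mu> m w \<and> Q w) \<longleftrightarrow> (\<exists>x\<in>{..<n}. unresolved I \<mu> m (Woman x) \<and> Q (Woman x))"
    by (rule bound) (rule conjunct2[OF uD])
  show "(\<exists>m. unresolved I \<mu> m w \<and> Q m) \<longleftrightarrow> (\<exists>x\<in>{..<n}. unresolved I \<mu> (Man x) w \<and> Q (Man x))"
    by (rule bound) (rule conjunct1[OF uD])
qed

text \<open>The conditions on \<open>i\<close> and \<open>j\<close>, here and below, exclude
  capture: a binder overwrites its variable, and the free variables must keep their values.\<close>

lemma e_unresolved [simp]:
  assumes "s 0 = N" "s i < n" "s j < n" "i \<noteq> 3" "j \<noteq> 3"
  shows "eval (e_unresolved i j) s M = of_bool (unresolved I \<mu> (Man (s i)) (Woman (s j)))"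
proof -
  let ?A = "\<exists>x\<in>{..<n}. (Man (s i), Woman x) \<in> \<mu> \<and> (Woman x, Woman (s j)) \<in> pref I (Man (s i))"
  let ?B = "\<exists>x\<in>{..<n}. (Man x, Woman (s j)) \<in> \<mu> \<and> (Man x, Man (s i)) \<in> pref I (Woman (s j))"
  have "?A \<longleftrightarrow> \<not> (\<forall>w'. (Man (s i), w') \<in> \<mu> \<longrightarrow> (w', Woman (s j)) \<notin> pref I (Man (s i)))"
    using ex_bounded(1)[of "s i" "\<lambda>w. (w, Woman (s j)) \<in> pref I (Man (s i))"] by simp
  moreover have "?B \<longleftrightarrow> \<not> (\<forall>m'. (m', Woman (s j)) \<in> \<mu> \<longrightarrow> (m', Man (s i)) \<notin> pref I (Woman (s j)))"
    using ex_bounded(2)[of "s j" "\<lambda>m. (m, Man (s i)) \<in> pref I (Woman (s j))"] by simp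
  moreover have "eval (e_unresolved i j) s M = of_bool ((Man (s i), Woman (s j)) \<in> acc I \<and>
      (Man (s i), Woman (s j)) \<notin> \<mu> \<and> \<not> ?A \<and> \<not> ?B)"
    using assms by (simp add: e_unresolved_def cong: bex_cong)
  ultimately show ?thesis unfolding unresolved_def by simp
qed

lemma e_forced [simp]:
  assumes "s 0 = N" "s i < n" "i \<notin> {3, 5, 6, 7}"
  shows "eval (e_forced i) s M = of_bool (forced I P \<mu> (Man (s i)))"
proof -
  have "eval (e_forced i) s M = of_bool (
      (\<exists>x\<in>{..<n}. unresolved I \<mu> (Man (s i)) (Woman x) \<and>
        \<not> (\<exists>y\<in>{..<n}. (Man y, Woman x) \<in> \<mu> \<and> (Man y, Man (s i)) \<in> P (Woman x))) \<or>
      (\<exists>x\<in>{..<n}. (Man (s i), Woman x) \<in> \<mu> \<and> (\<exists>y\<in>{..<n}. unresolved I \<mu> (Man y) (Woman x) \<and>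
        \<not> (\<exists>z\<in>{..<n}. (Man y, Woman z) \<in> \<mu> \<and> (Woman z, Woman x) \<in> P (Man y)))))"
    using assms by (simp add: e_forced_def cong: bex_cong)
  then show ?thesis unfolding forced_def ex_bounded .
qed

lemma e_interview [simp]:
  assumes "s 0 = N" "s i < n" "s j < n" "i \<notin> {3, 5, 6, 7, 8, 9}" "j \<notin> {3, 5, 6, 7, 8, 9}"
  shows "eval (e_interview i j) s M = of_bool ((Man (s i), Woman (s j)) \<in> interviews I P \<mu>)"
proof -
  let ?A = "\<exists>x\<in>{..<s i}. \<exists>y\<in>{..<n}. (Man x, Woman y) \<in> \<mu> \<and> \<not> forced I P \<mu> (Man x) \<and>
        unresolved I \<mu> (Man (s i)) (Woman y)"
  have "left_out I P \<mu> (s i) \<longleftrightarrow> \<not> forced I P \<mu> (Man (s i)) \<and> \<not> ?A"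
    unfolding left_out_def ex_bounded by blast
  moreover have "x < n" if "x < s i" for x using that assms(2) by simp
  then have "eval (e_interview i j) s M = of_bool (unresolved I \<mu> (Man (s i)) (Woman (s j)) \<or>
      (Man (s i), Woman (s j)) \<in> \<mu> \<and> \<not> (\<not> forced I P \<mu> (Man (s i)) \<and> \<not> ?A))"
    using assms by (simp add: e_interview_def cong: bex_cong)
  ultimately show ?thesis by (simp add: interviews_def)
qed

lemma opposite_interviews:
  "Woman c \<in> opposite (interviews I P \<mu>) (Man i) \<longleftrightarrow> (Man i, Woman c) \<in> interviews I P \<mu>"
  "Man c \<in> opposite (interviews I P \<mu>) (Woman i) \<longleftrightarrow> (Man c, Woman i) \<in> interviews I P \<mu>"
proof -
  have "interviews I P \<mu> \<subseteq> men I \<times> women I"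
    using acc \<mu> by (auto simp: interviews_def unresolved_def)
  then show "Woman c \<in> opposite (interviews I P \<mu>) (Man i) \<longleftrightarrow> (Man i, Woman c) \<in> interviews I P \<mu>"
    "Man c \<in> opposite (interviews I P \<mu>) (Woman i) \<longleftrightarrow> (Man c, Woman i) \<in> interviews I P \<mu>"
    by (auto simp: opposite_def men_def women_def)
qed

lemma e_output:
  fixes J :: instance_data
  defines "J \<equiv> interviewed I P (interviews I P \<mu>)"
  assumes s: "s 0 = N" and pos: "s 1 < length (enc_instance J)"
  shows "eval e_output s M = of_bool (enc_instance J ! s 1)"
proof -
  let ?b = "n + 1 + n * n" and ?T = "interviews I P \<mu>"
  let ?man = "\<lambda>i c d. s 1 = ?b + ((i * n + c) * n + d) \<and> (Man i, Woman c) \<in> ?T \<and> (Man i, Woman d) \<in> ?T \<and>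
      (Woman c, Woman d) \<in> P (Man i)"
  let ?woman = "\<lambda>i c d. s 1 = ?b + (((n + i) * n + c) * n + d) \<and> (Man c, Woman i) \<in> ?T \<and> (Man d, Woman i) \<in> ?T \<and>
      (Man c, Man d) \<in> P (Woman i)"
  have len: "length (enc_instance J) = ?b + (n + n) * n * n"
    using length_enc_instance[of J] by (simp add: J_def n)
  have ev: "eval e_output s M = of_bool (M (s 1) \<noteq> 0 \<or> (\<exists>i\<in>{..<n}. \<exists>c\<in>{..<n}. \<exists>d\<in>{..<n}. ?man i c d) \<or>
      (\<exists>i\<in>{..<n}. \<exists>c\<in>{..<n}. \<exists>d\<in>{..<n}. ?woman i c d))"
    using s by (simp add: e_output_def cong: bex_cong)
  show ?thesis
  proof (cases "s 1 < ?b")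
    case True
    \<comment> \<open>Below \<open>?b\<close> no triple has this position, so only the copied bit is
      left.\<close>
    then have "eval e_output s M = of_bool (M (s 1) \<noteq> 0)" unfolding ev by auto
    moreover have "enc_instance J ! s 1 = enc_input (I, P, \<mu>) ! s 1"
      using True by (intro enc_instance_nth_prefix) (simp_all add: J_def n)
    ultimately show ?thesis using M[of "s 1"] True N unfolding xs[symmetric] by simp
  next
    case False
    define k where "k = s 1 - ?b"
    have s1: "s 1 = ?b + k" using False by (simp add: k_def)
    have k: "k < (n + n) * n * n" using pos s1 len by simp
    obtain x c d where x: "x < n + n" "c < n" "d < n" "k = (x * n + c) * n + d"
      using index3_exists[OF k] by blast
    have enc: "enc_instance J ! s 1 = enc_profile n (pref J) ! k"
      unfolding s1 using enc_instance_nth_profile[of k J] k by (simp add: J_def n)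
    have s1x: "s 1 = ?b + ((x * n + c) * n + d)" using s1 x(4) by simp
    have inj: "x' = x \<and> c' = c \<and> d' = d" if "s 1 = ?b + ((x' * n + c') * n + d')" "c' < n" "d' < n" for x' c' d'
      using that x index3_inject[of c' n d' c d x' x] s1x by simp
    show ?thesis
    proof (cases "x < n")
      case True
      have "(\<exists>i\<in>{..<n}. \<exists>c\<in>{..<n}. \<exists>d\<in>{..<n}. ?man i c d) \<longleftrightarrow> ?man x c d"
        using inj True x(2,3) by blast
      moreover have "\<not> (\<exists>i\<in>{..<n}. \<exists>c\<in>{..<n}. \<exists>d\<in>{..<n}. ?woman i c d)"
        using inj True by fastforce
      moreover have "M (s 1) = of_bool ((Woman c, Woman d) \<in> pref I (Man x))"
        unfolding s1x by (rule M_cells(4)[OF True x(2,3)])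
      moreover have "enc_profile n (pref J) ! k \<longleftrightarrow> (Woman c, Woman d) \<in> pref J (Man x)"
        unfolding x(4) by (rule nth_enc_profile(1)[OF True x(2,3)])
      ultimately show ?thesis
        unfolding ev enc using s1x by (auto simp: J_def opposite_interviews)
    next
      case False
      then obtain j where j: "x = n + j" "j < n" using x(1) by (metis add_less_cancel_left le_add_diff_inverse not_less)
      have "(\<exists>i\<in>{..<n}. \<exists>c\<in>{..<n}. \<exists>d\<in>{..<n}. ?woman i c d) \<longleftrightarrow> ?woman j c d"
      proof
        assume "\<exists>i\<in>{..<n}. \<exists>c\<in>{..<n}. \<exists>d\<in>{..<n}. ?woman i c d"
        then obtain i c' d' where w: "c' < n" "d' < n" "?woman i c' d'" by blast
        then have "n + i = x \<and> c' = c \<and> d' = d" by (intro inj) blast+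
        then show "?woman j c d" using w j by simp
      qed (use j x in blast)
      moreover have "\<not> (\<exists>i\<in>{..<n}. \<exists>c\<in>{..<n}. \<exists>d\<in>{..<n}. ?man i c d)"
        using inj False by blast
      moreover have "M (s 1) = of_bool ((Man c, Man d) \<in> pref I (Woman j))"
        unfolding s1x j(1) by (rule M_cells(5)[OF j(2) x(2,3)])
      moreover have "enc_profile n (pref J) ! k \<longleftrightarrow> (Man c, Man d) \<in> pref J (Woman j)"
        unfolding x(4) j(1) by (rule nth_enc_profile(2)[OF j(2) x(2,3)])
      ultimately show ?thesis
        unfolding ev enc using s1x j(1) by (auto simp: J_def opposite_interviews)
    qed
  qed
qed

end

theorem theorem19:
  shows "solvable_in_polynomial_time
    {(I, P, \<mu>). min_ICR_exact_input (I, P, \<mu>) \<and> SMTI_common_classes I}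
    enc_input enc_instance min_ICR_exact_solution"
proof (rule polynomial_time_by_expressions[where L = e_profile_pos and e = e_output])
  fix x assume "x \<in> {(I, P, \<mu>). min_ICR_exact_input (I, P, \<mu>) \<and> SMTI_common_classes I}"
  then obtain I P \<mu> where x: "x = (I, P, \<mu>)" "min_ICR_exact_input (I, P, \<mu>)" "SMTI_common_classes I"
    by blast
  let ?J = "interviewed I P (interviews I P \<mu>)"
  have acc: "acc I \<subseteq> men I \<times> women I" "\<mu> \<subseteq> acc I"
    using x(2) by (auto simp: SMPI_def matching_def)
  have "eval e_profile_pos s M = length (enc_instance ?J) \<and>
      (s 1 < length (enc_instance ?J) \<longrightarrow> eval e_output s M = of_bool (enc_instance ?J ! s 1))"
    if "s 0 = length (enc_input x)" "\<forall>a<length (enc_input x). M a = of_bool (enc_input x ! a)" for s M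
  proof -
    interpret encoded I P \<mu> "num I" "enc_input x" M
      by unfold_locales (use that acc x(1) in blast)+
    \<comment> \<open>The start of the encoded profile serves as the output length: in the input the
      profile follows the encoding of \<open>I\<close>, and \<open>?J\<close> has an encoding of the
      same length.\<close>
    show ?thesis
      using e_positions(3)[of s] e_output[of s] that(1) by (simp add: length_enc_instance)
  qed
  then show "\<exists>y. min_ICR_exact_solution x y \<and> (\<forall>s M. s 0 = length (enc_input x) \<longrightarrow>
      (\<forall>a<length (enc_input x). M a = of_bool (enc_input x ! a)) \<longrightarrow>
      eval e_profile_pos s M = length (enc_instance y) \<and>
      (s 1 < length (enc_instance y) \<longrightarrow> eval e_output s M = of_bool (enc_instance y ! s 1)))"
    using min_ICR_exact_solution_interviewed[OF x(2,3)] x(1) by blast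
qed

end
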